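(* Fix a subcarrier $n$ and $M\ge 1$. The precomputation of algorithm i-SCUS has complexity $O(MK^2)$, and any subsequent evaluation i-SCUS$(\bar P^n)$ with $\bar P^n\le P_{max}$ costs $O(MK)$. Hence, for $C$ different power budgets (each at most $P_{max}$), i-SCUS computes their respective optimal single-carrier power control and user selection, i.e. an optimal solution of $\mathcal P'_{SC}(n)$ for each budget, with overall complexity $O(MK^2+CMK)$.
   Context: Setting. $K\ge 1$ users, a subcarrier $n$ with bandwidth $W_n>0$, weights $w_1,\dots,w_K>0$, normalized noise powers $\tilde\eta^n_k>0$, and a permutation $\pi_n$ of $\{1,\dots,K\}$ with $\tilde\eta^n_{\pi_n(1)}\ge\dots\ge\tilde\eta^n_{\pi_n(K)}$. For $1\le j\le i\le K$ define $$f^n_{j,i}(x)=\begin{cases}W_n w_{\pi_n(i)}\log_2(x+\tilde\eta^n_{\pi_n(i)}) & j=1,\\ W_n\left[w_{\pi_n(i)}\log_2(x+\tilde\eta^n_{\pi_n(i)})-w_{\pi_n(j-1)}\log_2(x+\tilde\eta^n_{\pi_n(j-1)})\right] & j>1,\end{cases}$$ and $f^n_i=f^n_{i,i}$ (so $f^n_{j,i}=\sum_{l=j}^i f^n_l$). Let $A^n=W_n w_{\pi_n(K)}\log_2(1/\tilde\eta^n_{\pi_n(K)})$. Problem $\mathcal P'_{SC}(n)$ with budget $\bar P^n\ge0$: maximize $\sum_{i=1}^K f^n_i(x^n_i)+A^n$ over $\boldsymbol x^n=(x^n_1,\dots,x^n_K)$ subject to $\bar P^n\ge x^n_1\ge\dots\ge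 x^n_K\ge0$ and $|\mathcal U'_n|\le M$, where $\mathcal U'_n=\{i\in\{1,\dots,K\}:x^n_i>x^n_{i+1}\}$ with $x^n_{K+1}=0$ is the set of active users. Argmax. For $1\le j\le i\le K$, with $a=\pi_n(i)$ and (if $j>1$) $b=\pi_n(j-1)$: $\mathrm{Argmax}f(j,i,\bar P^n)=\bar P^n$ if $j=1$ or $w_a\ge w_b$, and otherwise $\max\{0,\min\{\frac{w_b\tilde\eta^n_a-w_a\tilde\eta^n_b}{w_a-w_b},\bar P^n\}\}$. Algorithm SCUS$(M,\bar P^n)$. Arrays $V,X,U$ are indexed by $(m,j,i)$ with $0\le m\le M$, $1\le j\le i\le K$. Initialization: $V[0,j,i]=f^n_{j,K}(0)$, $X[0,j,i]=0$, $U[0,j,i]=\varnothing$ for all $j\le i$; and for $m=1,\dots,M$, $j=1,\dots,K$, with $x^*=\mathrm{Argmax}f(j,K,\bar P^n)$: $V[m,j,K]=f^n_{j,K}(x^* )$, $X[m,j,K]=x^*$, $U[m,j,K]=\varnothing$. Then for $i=K-1$ down to $1$, $m=1$ to $M$, $j=i$ down to $1$: let $x^*=\mathrm{Argmax}f(j,i,\bar P^n)$, $v_{act}=f^n_{j,i}(x^* )+V[m-1,i+1,i+1]$, $v_{inact}=V[m,j,i+1]$; if $v_{act}>v_{inact}$ and $x^*>X[m-1,i+1,i+1]$, set $V[m,j,i]=v_{act}$, $X[m,j,i]=x^*$, $U[m,j,i]=(m-1,i+1,i+1)$; otherwise set $V[m,j,i]=v_{inact}$, $X[m,j,i]=X[m,j,i+1]$,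 $U[m,j,i]=(m,j,i+1)$. Retrieval from an index $(m,j,i)$: start from $x^n_1=\dots=x^n_K=0$; repeat: set $x^n_j,\dots,x^n_i\leftarrow X[m,j,i]$ and $(m,j,i)\leftarrow U[m,j,i]$, until $(m,j,i)=\varnothing$. SCUS returns the vector retrieved from $(M,1,1)$. Algorithm i-SCUS. Precomputation: given $P_{max}$, compute $V,X,U$ as in SCUS$(M,P_{max})$; for each $i=1,\dots,K$, retrieve from $(M,1,i)$ the vector $x^n_1,\dots,x^n_K$ and its active set $\mathcal U'_n$, and store $(\mathcal U'_n,x^n_1,\dots,x^n_K)$ in a list called collection. Evaluation i-SCUS$(\bar P^n)$, $\bar P^n\le P_{max}$: choose the element of collection maximizing $\sum_{l=1}^{|\mathcal U'_n|}f^n_{(l-1)_n+1,\,l_n}(\min\{x^n_{l_n},\bar P^n\})+B^n$, where $\mathcal U'_n=\{1_n<2_n<\dots<|\mathcal U'_n|_n\}$, $0_n=0$, and $B^n=A^n$ if $|\mathcal U'_n|_n=K$, $B^n=f^n_{|\mathcal U'_n|_n+1,K}(0)+A^n$ otherwise; return $\min\{x^n_1,\bar P^n\},\dots,\min\{x^n_K,\bar P^n\}$ for that element. Complexity is the worst-case number of basic operations (real arithmetic, comparisons); one evaluation of $f^n_{j,i}$ or of $\mathrm{Argmax}f$ costs $O(1)$. *)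

theory Defs
  imports
    Complex_Main
    "HOL-Combinatorics.Permutations"
    "HOL-Library.Landau_Symbols"
    "HOL-Library.Monad_Syntax"
    "HOL-Library.While_Combinator"
begin

section \<open>Single-carrier power control and user selection\<close>

text \<open>
  All data belonging to one fixed subcarrier.  Users, positions in the decoding order and
  components of power vectors are numbered from 1; a vector is a function on \<^typ>\<open>nat\<close> of which
  only the components \<open>1, \<dots>, K\<close> are meaningful.  The field \<open>noise\<close> holds the normalized noise
  powers and \<open>sic_order\<close> the permutation that sorts them.
\<close>

record subcarrier =
  num_users :: nat
  bandwidth :: real
  weight :: "nat \<Rightarrow> real"
  noise :: "nat \<Rightarrow> real"
  sic_order :: "nat \<Rightarrow> nat"

definition valid_subcarrier :: "subcarrier \<Rightarrow> bool" where
  "valid_subcarrier G \<longleftrightarrow>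
     num_users G \<ge> 1 \<and> bandwidth G > 0 \<and>
     (\<forall>k\<in>{1..num_users G}. weight G k > 0 \<and> noise G k > 0) \<and>
     sic_order G permutes {1..num_users G} \<and>
     (\<forall>i j. 1 \<le> i \<and> i \<le> j \<and> j \<le> num_users G \<longrightarrow>
        noise G (sic_order G j) \<le> noise G (sic_order G i))"

definition f_term :: "subcarrier \<Rightarrow> nat \<Rightarrow> nat \<Rightarrow> real \<Rightarrow> real" where
  "f_term G j i x =
     (let a = sic_order G i; b = sic_order G (j - 1) in
      if j = 1 then bandwidth G * weight G a * log 2 (x + noise G a)
      else bandwidth G *
        (weight G a * log 2 (x + noise G a) - weight G b * log 2 (x + noise G b)))"

definition A_const :: "subcarrier \<Rightarrow> real" where
  "A_const G =
     (let a = sic_order G (num_users G) in bandwidth G * weight G a * log 2 (1 / noise G a))"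

definition objective :: "subcarrier \<Rightarrow> (nat \<Rightarrow> real) \<Rightarrow> real" where
  "objective G x = (\<Sum>i = 1..num_users G. f_term G i i (x i)) + A_const G"

definition next_power :: "subcarrier \<Rightarrow> (nat \<Rightarrow> real) \<Rightarrow> nat \<Rightarrow> real" where
  "next_power G x i = (if i < num_users G then x (i + 1) else 0)"

definition active_users :: "subcarrier \<Rightarrow> (nat \<Rightarrow> real) \<Rightarrow> nat set" where
  "active_users G x = {i \<in> {1..num_users G}. x i > next_power G x i}"

definition feasible :: "subcarrier \<Rightarrow> nat \<Rightarrow> real \<Rightarrow> (nat \<Rightarrow> real) \<Rightarrow> bool" where
  "feasible G M P x \<longleftrightarrow>
     x 1 \<le> P \<and> (\<forall>i\<in>{1..num_users G}. next_power G x i \<le> x i) \<and>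
     card (active_users G x) \<le> M"

definition optimal_solution :: "subcarrier \<Rightarrow> nat \<Rightarrow> real \<Rightarrow> (nat \<Rightarrow> real) \<Rightarrow> bool" where
  "optimal_solution G M P x \<longleftrightarrow>
     feasible G M P x \<and> (\<forall>y. feasible G M P y \<longrightarrow> objective G y \<le> objective G x)"

definition argmax_f :: "subcarrier \<Rightarrow> nat \<Rightarrow> nat \<Rightarrow> real \<Rightarrow> real" where
  "argmax_f G j i P =
     (let a = sic_order G i; b = sic_order G (j - 1) in
      if j = 1 \<or> weight G a \<ge> weight G b then P
      else max 0 (min ((weight G b * noise G a - weight G a * noise G b)
                        / (weight G a - weight G b)) P))"

section \<open>Programs with an operation count\<close>

text \<open>
  The count comprises real arithmetic (including logarithms), comparisons of reals, and the
  explicit tests of the algorithms.  Reading and assigning variables or table entries and the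
  bookkeeping of indices and loop counters are free.
\<close>

datatype 'a prog = Diverge | Done (result: 'a) (cost: nat)

definition charge :: "nat \<Rightarrow> 'a \<Rightarrow> 'a prog" where
  "charge n a = Done a n"

abbreviation return :: "'a \<Rightarrow> 'a prog" where
  "return \<equiv> charge 0"

definition bind_prog :: "'a prog \<Rightarrow> ('a \<Rightarrow> 'b prog) \<Rightarrow> 'b prog" where
  "bind_prog p q =
     (case p of
        Diverge \<Rightarrow> Diverge
      | Done a m \<Rightarrow> (case q a of Diverge \<Rightarrow> Diverge | Done b n \<Rightarrow> Done b (m + n)))"

adhoc_overloading Monad_Syntax.bind \<rightleftharpoons> bind_prog

primrec for_each :: "'i list \<Rightarrow> ('i \<Rightarrow> 's \<Rightarrow> 's prog) \<Rightarrow> 's \<Rightarrow> 's prog" where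
  "for_each [] body s = return s"
| "for_each (i # is) body s = do { s' \<leftarrow> body i s; for_each is body s' }"

text \<open>
  The charges below are the numbers of operations in the respective formulas, taken in the most
  expensive branch.
\<close>

definition eval_f :: "subcarrier \<Rightarrow> nat \<Rightarrow> nat \<Rightarrow> real \<Rightarrow> real prog" where
  "eval_f G j i x = charge 9 (f_term G j i x)"

definition eval_argmax :: "subcarrier \<Rightarrow> nat \<Rightarrow> nat \<Rightarrow> real \<Rightarrow> real prog" where
  "eval_argmax G j i P = charge 9 (argmax_f G j i P)"

definition eval_A :: "subcarrier \<Rightarrow> real prog" where
  "eval_A G = charge 4 (A_const G)"

section \<open>SCUS\<close>

type_synonym index = "nat \<times> nat \<times> nat"

text \<open>In \<open>tab_U\<close> the value \<^term>\<open>None\<close> is the end marker (the empty index).\<close>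

record tables =
  tab_V :: "index \<Rightarrow> real"
  tab_X :: "index \<Rightarrow> real"
  tab_U :: "index \<Rightarrow> index option"

definition store :: "index \<Rightarrow> real \<Rightarrow> real \<Rightarrow> index option \<Rightarrow> tables \<Rightarrow> tables" where
  "store k v x u T =
     \<lparr>tab_V = (tab_V T)(k := v), tab_X = (tab_X T)(k := x), tab_U = (tab_U T)(k := u)\<rparr>"

definition scus_init :: "subcarrier \<Rightarrow> nat \<Rightarrow> real \<Rightarrow> tables \<Rightarrow> tables prog" where
  "scus_init G M P T0 =
     (let K = num_users G in do {
        T1 \<leftarrow> for_each [1..<K + 1] (\<lambda>j. for_each [j..<K + 1] (\<lambda>i T. do {
          v \<leftarrow> eval_f G j K 0;
          return (store (0, j, i) v 0 None T)
        })) T0;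
        for_each [1..<M + 1] (\<lambda>m. for_each [1..<K + 1] (\<lambda>j T. do {
          x \<leftarrow> eval_argmax G j K P;
          v \<leftarrow> eval_f G j K x;
          return (store (m, j, K) v x None T)
        })) T1
      })"

definition scus_step ::
    "subcarrier \<Rightarrow> real \<Rightarrow> nat \<Rightarrow> nat \<Rightarrow> nat \<Rightarrow> tables \<Rightarrow> tables prog" where
  "scus_step G P i m j T = do {
     x \<leftarrow> eval_argmax G j i P;
     v \<leftarrow> eval_f G j i x;
     v_act \<leftarrow> charge 1 (v + tab_V T (m - 1, i + 1, i + 1));
     let v_inact = tab_V T (m, j, i + 1);
     activate \<leftarrow> charge 2 (v_act > v_inact \<and> x > tab_X T (m - 1, i + 1, i + 1));
     return (if activate
       then store (m, j, i) v_act x (Some (m - 1, i + 1, i + 1)) T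
       else store (m, j, i) v_inact (tab_X T (m, j, i + 1)) (Some (m, j, i + 1)) T)
   }"

definition scus_tables :: "subcarrier \<Rightarrow> nat \<Rightarrow> real \<Rightarrow> tables prog" where
  "scus_tables G M P = do {
     T \<leftarrow> scus_init G M P undefined;
     for_each (rev [1..<num_users G]) (\<lambda>i.
       for_each [1..<M + 1] (\<lambda>m.
         for_each (rev [1..<i + 1]) (\<lambda>j. scus_step G P i m j))) T
   }"

text \<open>
  The loop has the form repeat-until: its condition always holds at the first test.  Each pass is
  charged for the until-test.
\<close>

definition retrieve :: "tables \<Rightarrow> index \<Rightarrow> (nat \<Rightarrow> real) prog" where
  "retrieve T k0 =
     (case while_option
        (\<lambda>(u, x, c). u \<noteq> None)
        (\<lambda>(u, x, c). case the u of (m, j, i) \<Rightarrow>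
           (tab_U T (m, j, i), \<lambda>l. if j \<le> l \<and> l \<le> i then tab_X T (m, j, i) else x l, c + 1))
        (Some k0, \<lambda>_. 0, 0) of
        None \<Rightarrow> Diverge
      | Some (u, x, c) \<Rightarrow> Done x c)"

section \<open>i-SCUS\<close>

definition active_list :: "subcarrier \<Rightarrow> (nat \<Rightarrow> real) \<Rightarrow> nat list prog" where
  "active_list G x =
     for_each [1..<num_users G + 1]
       (\<lambda>i us. charge 1 (if x i > next_power G x i then us @ [i] else us)) []"

type_synonym collection = "(nat list \<times> (nat \<Rightarrow> real)) list"

definition iscus_precompute :: "subcarrier \<Rightarrow> nat \<Rightarrow> real \<Rightarrow> collection prog" where
  "iscus_precompute G M Pmax = do {
     T \<leftarrow> scus_tables G M Pmax;
     for_each [1..<num_users G + 1] (\<lambda>i coll. do {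
       x \<leftarrow> retrieve T (M, 1, i);
       us \<leftarrow> active_list G x;
       return (coll @ [(us, x)])
     }) []
   }"

text \<open>
  In the loop, \<open>p\<close> is the active user preceding \<open>i\<close>, or 0 if there is none; after the loop it is the
  last active user.
\<close>

definition clipped_value ::
    "subcarrier \<Rightarrow> real \<Rightarrow> nat list \<times> (nat \<Rightarrow> real) \<Rightarrow> real prog" where
  "clipped_value G P e =
     (let us = fst e; x = snd e; K = num_users G in do {
        (p, s) \<leftarrow> for_each us (\<lambda>i (p, s). do {
          y \<leftarrow> charge 1 (min (x i) P);
          v \<leftarrow> eval_f G (p + 1) i y;
          s' \<leftarrow> charge 1 (s + v);
          return (i, s')
        }) (0, 0);
        a \<leftarrow> eval_A G;
        full \<leftarrow> charge 1 (p = K);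
        if full then charge 1 (s + a)
        else do {
          v \<leftarrow> eval_f G (p + 1) K 0;
          charge 2 (s + (v + a))
        }
      })"

text \<open>Among several maximizing elements the first one is chosen.\<close>

definition iscus_choose :: "subcarrier \<Rightarrow> collection \<Rightarrow> real \<Rightarrow> (nat \<Rightarrow> real) prog" where
  "iscus_choose G coll P = do {
     best \<leftarrow> for_each coll (\<lambda>e best. do {
       v \<leftarrow> clipped_value G P e;
       case best of
         None \<Rightarrow> return (Some (v, snd e))
       | Some (v', x') \<Rightarrow> charge 1 (if v > v' then Some (v, snd e) else Some (v', x'))
     }) None;
     return (snd (the best))
   }"

definition iscus_eval :: "subcarrier \<Rightarrow> collection \<Rightarrow> real \<Rightarrow> (nat \<Rightarrow> real) prog" where
  "iscus_eval G coll P = do {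
     x \<leftarrow> iscus_choose G coll P;
     for_each [1..<num_users G + 1] (\<lambda>i y. charge 1 (y(i := min (x i) P))) (\<lambda>_. 0)
   }"

definition iscus :: "subcarrier \<Rightarrow> nat \<Rightarrow> real \<Rightarrow> real list \<Rightarrow> (nat \<Rightarrow> real) list prog" where
  "iscus G M Pmax Ps = do {
     coll \<leftarrow> iscus_precompute G M Pmax;
     for_each Ps (\<lambda>P ys. do {
       y \<leftarrow> iscus_eval G coll P;
       return (ys @ [y])
     }) []
   }"

section \<open>Admissible inputs\<close>

definition precompute_inputs :: "(subcarrier \<times> nat \<times> real) set" where
  "precompute_inputs = {(G, M, Pmax). valid_subcarrier G \<and> M \<ge> 1 \<and> Pmax \<ge> 0}"

definition eval_inputs :: "(subcarrier \<times> nat \<times> real \<times> real) set" where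
  "eval_inputs = {(G, M, Pmax, P). (G, M, Pmax) \<in> precompute_inputs \<and> P \<in> {0..Pmax}}"

definition iscus_inputs :: "(subcarrier \<times> nat \<times> real \<times> real list) set" where
  "iscus_inputs = {(G, M, Pmax, Ps). (G, M, Pmax) \<in> precompute_inputs \<and> set Ps \<subseteq> {0..Pmax}}"

end

theory Submission
  imports Defs
begin

text \<open>
  Write \<open>f\<^bsub>j,i\<^esub>\<close> for the value of a block of equal powers at the positions \<open>j, \<dots>, i\<close>.
  Since the noise powers decrease along the decoding order, the derivative of \<open>f\<^bsub>j,i\<^esub>\<close> changes
  sign at most once, from plus to minus.  Hence \<open>argmax_f\<close> maximizes \<open>f\<^bsub>j,i\<^esub>\<close> on \<open>[0, P]\<close>, and
  \<open>f\<^bsub>j,i\<^esub>\<close> is monotone on either side of this point.  (Increasing and decreasing are meant in the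
  weak sense.)  Two exchange lemmas extend this to nonincreasing vectors.  If some block function
  \<open>f\<^bsub>s,r\<^esub>\<close> increases on \<open>[0, y]\<close>, then a vector with \<open>x\<^sub>s \<le> y\<close> can be raised to the constant
  \<open>y\<close> on a whole initial block \<open>s, \<dots>, q\<close> without loss (\<open>raise_to\<close>).  If every block function
  starting at \<open>s\<close> decreases beyond \<open>y\<close>, then a vector can be lowered to \<open>y\<close> wherever it exceeds \<open>y\<close>
  without loss (\<open>lower_to\<close>).

  \<^bold>\<open>The tables.\<close>  The entry \<open>(m, j, i)\<close> stands for the problem on the positions \<open>j, \<dots>, K\<close> with equal
  powers at \<open>j, \<dots>, i\<close> and at most \<open>m\<close> active users among \<open>i, \<dots>, K\<close>; it is optimal, and
  retrieval produces a vector that attains it (\<open>table_optimal\<close>).  The induction runs downwards in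
  \<open>i\<close>.  The delicate case is \<open>x* \<le> z\<close>, where \<open>x*\<close> maximizes \<open>f\<^bsub>j,i\<^esub>\<close> and \<open>z\<close> is the first power of the
  optimal continuation, so that the algorithm refuses to make \<open>i\<close> active.  Take a competitor with
  power \<open>y\<close> on \<open>j, \<dots>, i\<close> and a smaller power afterwards.  If \<open>y \<ge> z\<close>, lowering the first block to
  \<open>z\<close> and appending the optimal continuation is no worse.  If \<open>y < z\<close>, then \<open>z\<close> is the maximizer of
  a block function starting at \<open>i + 1\<close>, which therefore increases on \<open>[0, y]\<close>, and the competitor can
  be raised to \<open>y\<close> on an initial part of its continuation.  Either way \<open>i\<close> is inactive and the new
  vector competes for the entry \<open>(m, j, i + 1)\<close>.

  \<^bold>\<open>Smaller budgets.\<close>  For a budget \<open>P > 0\<close> one may assume that the powers are \<open>P\<close> on \<open>1, \<dots>, i\<close> and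
  smaller afterwards.  If some block function starting at \<open>i + 1\<close> increases on \<open>[0, P]\<close>, raising gives
  a longer first block.  Otherwise all of them decrease beyond \<open>P\<close>, and the optimal continuation
  for the budget \<open>Pmax\<close> starts below \<open>P\<close>.  If the algorithm made \<open>i\<close> active, the vector
  retrieved from \<open>(M, 1, i)\<close>, clipped at \<open>P\<close>, is no worse than the competitor.  If it did not, the
  vector retrieved from \<open>(M, 1, i + 1)\<close> is at least as good beyond \<open>i\<close>, and lowering it to \<open>P\<close> gives
  again a longer first block.  By downward induction on \<open>i\<close>, some vector of the collection, clipped at
  \<open>P\<close>, is optimal (\<open>clipped_covers\<close>, \<open>clipped_optimal\<close>).

  \<^bold>\<open>Operation counts.\<close>  They follow from a bound for each loop body.  A retrieval takes at most
  \<open>K\<close> passes because each link leads to an entry with a larger last component, and evaluating one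
  element of the collection takes \<open>O(M)\<close> operations because it has at most \<open>M\<close> active users.
\<close>

section \<open>The block functions\<close>

text \<open>
  The sign of the derivative of \<^term>\<open>f_term G j i\<close> at \<open>y \<ge> 0\<close>, with the positive denominators
  cleared: \<open>rising\<close> means that it is nonnegative, \<open>falling\<close> that it is nonpositive.  For \<open>j = 1\<close>
  there is no subtracted term and the function always rises.
\<close>

definition rising :: "subcarrier \<Rightarrow> nat \<Rightarrow> nat \<Rightarrow> real \<Rightarrow> bool" where
  "rising G j i y \<longleftrightarrow>
     (let a = sic_order G i; b = sic_order G (j - 1) in
      j = 1 \<or> weight G b * (y + noise G a) \<le> weight G a * (y + noise G b))"

definition falling :: "subcarrier \<Rightarrow> nat \<Rightarrow> nat \<Rightarrow> real \<Rightarrow> bool" where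
  "falling G j i y \<longleftrightarrow>
     (let a = sic_order G i; b = sic_order G (j - 1) in
      j \<noteq> 1 \<and> weight G a * (y + noise G b) \<le> weight G b * (y + noise G a))"

lemma falling_if_not_rising: "\<not> rising G j i y \<Longrightarrow> falling G j i y"
  by (auto simp: rising_def falling_def Let_def)

lemma f_term_split:
  assumes "1 \<le> j" "j \<le> r" "r < i"
  shows "f_term G j i x = f_term G j r x + f_term G (r + 1) i x"
  using assms by (auto simp: f_term_def Let_def algebra_simps)

lemma f_term_sum:
  assumes "1 \<le> j" "j \<le> i"
  shows "(\<Sum>l = j..i. f_term G l l x) = f_term G j i x"
  using assms(2)
proof (induction i rule: dec_induct)
  case base
  show ?case by simp
next
  case (step n)
  then show ?case using f_term_split[of j n "Suc n" G x] assms(1) by simp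
qed

text \<open>
  The contribution of the positions \<open>s, \<dots>, K\<close> to the objective.
\<close>

definition tail :: "subcarrier \<Rightarrow> nat \<Rightarrow> (nat \<Rightarrow> real) \<Rightarrow> real" where
  "tail G s x = (\<Sum>l = s..num_users G. f_term G l l (x l))"

lemma tail_split:
  assumes "s \<le> q + 1" "q \<le> num_users G"
  shows "tail G s x = (\<Sum>l = s..q. f_term G l l (x l)) + tail G (q + 1) x"
proof -
  have "{s..num_users G} = {s..q} \<union> {q + 1..num_users G}" "{s..q} \<inter> {q + 1..num_users G} = {}"
    using assms by auto
  then show ?thesis unfolding tail_def by (simp add: sum.union_disjoint)
qed

lemma tail_cong:
  assumes "\<And>l. s \<le> l \<Longrightarrow> l \<le> num_users G \<Longrightarrow> x l = y l"
  shows "tail G s x = tail G s y"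
  unfolding tail_def using assms by (auto intro: sum.cong)

lemma block_const:
  assumes "1 \<le> s" "s \<le> q" "\<And>l. s \<le> l \<Longrightarrow> l \<le> q \<Longrightarrow> x l = c"
  shows "(\<Sum>l = s..q. f_term G l l (x l)) = f_term G s q c"
proof -
  have "(\<Sum>l = s..q. f_term G l l (x l)) = (\<Sum>l = s..q. f_term G l l c)"
    using assms by (intro sum.cong) auto
  then show ?thesis using f_term_sum assms by simp
qed

lemma tail_block:
  assumes "1 \<le> s" "s \<le> q" "q \<le> num_users G" "\<And>l. s \<le> l \<Longrightarrow> l \<le> q \<Longrightarrow> x l = c"
  shows "tail G s x = f_term G s q c + tail G (q + 1) x"
  using tail_split[of s q G x] block_const[of s q x c G] assms by simp

lemma tail_empty [simp]: "tail G (Suc (num_users G)) x = 0"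
  by (simp add: tail_def)

locale sorted_subcarrier =
  fixes G :: subcarrier
  assumes valid: "valid_subcarrier G"
begin

abbreviation "K \<equiv> num_users G"

lemma K_ge_1: "1 \<le> K"
  using valid by (simp add: valid_subcarrier_def)

lemma bandwidth_pos: "bandwidth G > 0"
  using valid by (simp add: valid_subcarrier_def)

lemma position_in_range:
  assumes "1 \<le> i" "i \<le> K"
  shows "sic_order G i \<in> {1..K}"
proof -
  have "sic_order G permutes {1..K}" using valid by (simp add: valid_subcarrier_def)
  then show ?thesis using assms by (subst permutes_in_image) auto
qed

lemma weight_pos:
  assumes "1 \<le> i" "i \<le> K"
  shows "weight G (sic_order G i) > 0"
  using valid position_in_range[OF assms] by (simp add: valid_subcarrier_def)

lemma noise_pos:
  assumes "1 \<le> i" "i \<le> K"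
  shows "noise G (sic_order G i) > 0"
  using valid position_in_range[OF assms] by (simp add: valid_subcarrier_def)

lemma noise_sorted:
  assumes "1 \<le> i" "i \<le> j" "j \<le> K"
  shows "noise G (sic_order G j) \<le> noise G (sic_order G i)"
  using valid assms by (simp add: valid_subcarrier_def)

text \<open>
  With positive weights and decreasing noise powers a block function never rises again once it
  falls: \<open>rising\<close> passes to smaller arguments and \<open>falling\<close> to larger ones.
\<close>

lemma rising_downward:
  assumes "rising G j i y" "1 \<le> j" "j \<le> i" "i \<le> K" "0 \<le> x" "x \<le> y"
  shows "rising G j i x"
proof (cases "j = 1")
  case False
  let ?a = "sic_order G i" and ?b = "sic_order G (j - 1)"
  have w: "weight G ?a > 0" "weight G ?b > 0" "noise G ?a > 0" "noise G ?a \<le> noise G ?b"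
    using assms False by (auto intro!: weight_pos noise_pos noise_sorted)
  have h: "weight G ?b * (y + noise G ?a) \<le> weight G ?a * (y + noise G ?b)"
    using assms(1) False by (simp add: rising_def Let_def)
  have "weight G ?b * (x + noise G ?a) \<le> weight G ?a * (x + noise G ?b)"
  proof (cases "weight G ?b \<le> weight G ?a")
    case True
    then show ?thesis using w assms by (intro mult_mono) auto
  next
    case False
    have "(weight G ?b - weight G ?a) * x \<le> (weight G ?b - weight G ?a) * y"
      using False assms by (intro mult_left_mono) auto
    then show ?thesis using h by (simp add: algebra_simps)
  qed
  then show ?thesis by (simp add: rising_def Let_def)
qed (simp add: rising_def)

lemma falling_upward:
  assumes "falling G j i y" "1 \<le> j" "j \<le> i" "i \<le> K" "0 \<le> y" "y \<le> x"
  shows "falling G j i x"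
proof -
  let ?a = "sic_order G i" and ?b = "sic_order G (j - 1)"
  have j: "j \<noteq> 1" and
    h: "weight G ?a * (y + noise G ?b) \<le> weight G ?b * (y + noise G ?a)"
    using assms(1) by (simp_all add: falling_def Let_def)
  have w: "weight G ?a > 0" "weight G ?b > 0" "noise G ?a > 0" "noise G ?a \<le> noise G ?b"
    using assms j by (auto intro!: weight_pos noise_pos noise_sorted)
  have le: "weight G ?a \<le> weight G ?b"
  proof (rule ccontr)
    assume "\<not> ?thesis"
    then have "weight G ?b * (y + noise G ?b) < weight G ?a * (y + noise G ?b)"
      using w assms by (intro mult_strict_right_mono) auto
    moreover have "weight G ?b * (y + noise G ?a) \<le> weight G ?b * (y + noise G ?b)"
      using w by (intro mult_left_mono) auto
    ultimately show False using h by linarith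
  qed
  have "(weight G ?b - weight G ?a) * y \<le> (weight G ?b - weight G ?a) * x"
    using le assms by (intro mult_left_mono) auto
  then show ?thesis using h j by (simp add: falling_def Let_def algebra_simps)
qed

lemma f_term_deriv:
  assumes "1 \<le> j" "j \<le> i" "i \<le> K" "0 \<le> x"
  shows "(f_term G j i has_real_derivative
     (if j = 1 then bandwidth G * weight G (sic_order G i) / (x + noise G (sic_order G i)) / ln 2
      else bandwidth G / ln 2 *
        (weight G (sic_order G i) / (x + noise G (sic_order G i)) -
         weight G (sic_order G (j - 1)) / (x + noise G (sic_order G (j - 1)))))) (at x)"
proof -
  have log: "((\<lambda>t. log 2 (t + c)) has_real_derivative 1 / (x + c) / ln 2) (at x)" if "c > 0" for c
    using that assms(4) unfolding log_def by (auto intro!: derivative_eq_intros)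
  have a: "noise G (sic_order G i) > 0" using assms by (intro noise_pos) auto
  show ?thesis
  proof (cases "j = 1")
    case True
    have eq: "f_term G j i =
        (\<lambda>x. bandwidth G * weight G (sic_order G i) * log 2 (x + noise G (sic_order G i)))"
      using True by (auto simp: f_term_def Let_def)
    show ?thesis unfolding eq using True
      by (auto intro!: DERIV_cong[OF DERIV_cmult[OF log[OF a]]])
  next
    case False
    then have b: "noise G (sic_order G (j - 1)) > 0" using assms by (intro noise_pos) auto
    have eq: "f_term G j i =
        (\<lambda>x. bandwidth G * (weight G (sic_order G i) * log 2 (x + noise G (sic_order G i)) -
          weight G (sic_order G (j - 1)) * log 2 (x + noise G (sic_order G (j - 1)))))"
      using False by (auto simp: f_term_def Let_def)
    show ?thesis unfolding eq
      by (rule DERIV_cong[OF DERIV_cmult[OF DERIV_diff[OF DERIV_cmult[OF log[OF a]]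
            DERIV_cmult[OF log[OF b]]]]])
        (use False in \<open>simp add: diff_divide_distrib right_diff_distrib mult.commute\<close>)
  qed
qed

lemma f_term_mono:
  assumes "rising G j i y" "1 \<le> j" "j \<le> i" "i \<le> K" "0 \<le> x" "x \<le> y"
  shows "f_term G j i x \<le> f_term G j i y"
proof (rule DERIV_nonneg_imp_nondecreasing[OF \<open>x \<le> y\<close>])
  fix t assume t: "x \<le> t" "t \<le> y"
  have r: "rising G j i t" using rising_downward[of j i y t] assms t by auto
  let ?a = "sic_order G i" and ?b = "sic_order G (j - 1)"
  have w: "weight G ?a > 0" "noise G ?a > 0" using assms by (auto intro!: weight_pos noise_pos)
  have t0: "0 \<le> t" using t assms by simp
  show "\<exists>d. (f_term G j i has_real_derivative d) (at t) \<and> 0 \<le> d"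
  proof (intro exI conjI, rule f_term_deriv[OF assms(2-4) t0])
    show "0 \<le> (if j = 1 then bandwidth G * weight G ?a / (t + noise G ?a) / ln 2
      else bandwidth G / ln 2 *
        (weight G ?a / (t + noise G ?a) - weight G ?b / (t + noise G ?b)))"
    proof (cases "j = 1")
      case True
      then show ?thesis using w bandwidth_pos t0 by simp
    next
      case False
      have "noise G ?b > 0" using assms False by (auto intro!: noise_pos)
      then have "weight G ?b / (t + noise G ?b) \<le> weight G ?a / (t + noise G ?a)"
        using r False w t0 by (simp add: rising_def Let_def frac_le_eq field_simps)
      then show ?thesis using False bandwidth_pos by simp
    qed
  qed
qed

lemma f_term_antimono:
  assumes "falling G j i x" "1 \<le> j" "j \<le> i" "i \<le> K" "0 \<le> x" "x \<le> y"
  shows "f_term G j i y \<le> f_term G j i x"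
proof (rule DERIV_nonpos_imp_nonincreasing[OF \<open>x \<le> y\<close>])
  fix t assume t: "x \<le> t" "t \<le> y"
  have r: "falling G j i t" using falling_upward[of j i x t] assms t by auto
  then have j: "j \<noteq> 1" by (simp add: falling_def Let_def)
  let ?a = "sic_order G i" and ?b = "sic_order G (j - 1)"
  have w: "noise G ?a > 0" "noise G ?b > 0" using assms j by (auto intro!: noise_pos)
  have t0: "0 \<le> t" using t assms by simp
  have "weight G ?a / (t + noise G ?a) \<le> weight G ?b / (t + noise G ?b)"
    using r w t0 by (simp add: falling_def Let_def field_simps)
  then have "bandwidth G / ln 2 *
      (weight G ?a / (t + noise G ?a) - weight G ?b / (t + noise G ?b)) \<le> 0"
    using bandwidth_pos by (intro mult_nonneg_nonpos) auto
  then show "\<exists>d. (f_term G j i has_real_derivative d) (at t) \<and> d \<le> 0"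
    using f_term_deriv[OF assms(2-4) t0] j by (intro exI conjI) auto
qed

lemma argmax_f_range:
  assumes "0 \<le> P"
  shows "0 \<le> argmax_f G j i P" "argmax_f G j i P \<le> P"
  using assms by (auto simp: argmax_f_def Let_def)

lemma rising_below_argmax_f:
  assumes "y \<le> argmax_f G j i P" "0 < y" "1 \<le> j" "j \<le> i" "i \<le> K"
  shows "rising G j i y"
proof (cases "j = 1")
  case False
  let ?a = "sic_order G i" and ?b = "sic_order G (j - 1)"
  have w: "weight G ?a > 0" "weight G ?b > 0" "noise G ?a > 0" "noise G ?a \<le> noise G ?b"
    using assms False by (auto intro!: weight_pos noise_pos noise_sorted)
  show ?thesis
  proof (cases "weight G ?b \<le> weight G ?a")
    case True
    then have "weight G ?b * (y + noise G ?a) \<le> weight G ?a * (y + noise G ?b)"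
      using w assms by (intro mult_mono) auto
    then show ?thesis by (simp add: rising_def Let_def)
  next
    case lt: False
    then have "y \<le> (weight G ?b * noise G ?a - weight G ?a * noise G ?b)
                        / (weight G ?a - weight G ?b)"
      using assms False by (auto simp: argmax_f_def Let_def)
    then show ?thesis using lt by (simp add: rising_def Let_def field_simps)
  qed
qed (simp add: rising_def)

lemma falling_at_argmax_f:
  assumes "argmax_f G j i P < P"
  shows "falling G j i (argmax_f G j i P)"
proof -
  let ?a = "sic_order G i" and ?b = "sic_order G (j - 1)"
  let ?c = "(weight G ?b * noise G ?a - weight G ?a * noise G ?b) / (weight G ?a - weight G ?b)"
  have j: "j \<noteq> 1" "weight G ?a < weight G ?b" and le: "?c \<le> argmax_f G j i P"
    using assms by (auto simp: argmax_f_def Let_def split: if_splits)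
  show ?thesis using le j by (simp add: falling_def Let_def field_simps)
qed

lemma f_term_antimono_above_argmax:
  assumes "argmax_f G j i P \<le> x" "x \<le> y" "y \<le> P" "0 \<le> P" "1 \<le> j" "j \<le> i" "i \<le> K"
  shows "f_term G j i y \<le> f_term G j i x"
proof (cases "x = P")
  case False
  have c: "0 \<le> argmax_f G j i P" "argmax_f G j i P < P"
    using argmax_f_range[of P j i] assms False by auto
  have "falling G j i x"
    using falling_upward[OF falling_at_argmax_f[OF c(2)], of x] c assms by simp
  then show ?thesis using f_term_antimono assms c by simp
qed (use assms in simp)

lemma f_term_le_argmax:
  assumes "0 \<le> x" "x \<le> P" "1 \<le> j" "j \<le> i" "i \<le> K"
  shows "f_term G j i x \<le> f_term G j i (argmax_f G j i P)"
proof -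
  let ?c = "argmax_f G j i P"
  consider "?c \<le> x" | "x < ?c" by linarith
  then show ?thesis
  proof cases
    case 1
    then show ?thesis using f_term_antimono_above_argmax[of j i P ?c x] assms by simp
  next
    case 2
    then show ?thesis
      using f_term_mono[OF rising_below_argmax_f[of ?c j i P], of x] assms by simp
  qed
qed

text \<open>
  The first exchange lemma.  Take the shortest block \<open>s, \<dots>, q\<close> whose function still rises at
  \<open>y\<close>.  Each shorter block \<open>s, \<dots>, r\<close> falls there, so every remainder \<open>r + 1, \<dots>, q\<close> rises at \<open>y\<close>.
  Hence, for \<open>t\<close> from \<open>q - 1\<close> down to \<open>s\<close>, the remainder \<open>t + 1, \<dots>, q\<close> can be raised to the power at
  position \<open>t\<close>, and finally the whole block to \<open>y\<close>.
\<close>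

lemma raise_to:
  assumes rising: "rising G s q0 y" and s: "1 \<le> s" "s \<le> q0" "q0 \<le> K"
    and dec: "\<And>l. s \<le> l \<Longrightarrow> x (l + 1) \<le> x l" and nonneg: "\<And>l. s \<le> l \<Longrightarrow> 0 \<le> x l" and "x s \<le> y"
  shows "\<exists>q\<in>{s..q0}. (\<Sum>l = s..q. f_term G l l (x l)) \<le> f_term G s q y"
proof -
  define q where "q = (LEAST q. s \<le> q \<and> rising G s q y)"
  have q: "s \<le> q" "rising G s q y"
    using LeastI[of "\<lambda>q. s \<le> q \<and> rising G s q y" q0] rising s by (auto simp: q_def)
  have "q \<le> q0" unfolding q_def using rising s by (intro Least_le) auto
  have min: "\<not> rising G s r y" if "s \<le> r" "r < q" for r
    using not_less_Least[of r "\<lambda>q. s \<le> q \<and> rising G s q y"] that by (auto simp: q_def)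
  have y0: "0 \<le> y" using nonneg[of s] \<open>x s \<le> y\<close> by simp
  \<comment> \<open>Compare \<open>w / (y + noise)\<close> at the positions \<open>r\<close>, \<open>s - 1\<close> and \<open>q\<close>: these values increase.\<close>
  have sub: "rising G (r + 1) q y" if r: "s \<le> r" "r < q" for r
  proof -
    let ?a = "sic_order G q" and ?b = "sic_order G (s - 1)" and ?c = "sic_order G r"
    have "s \<noteq> 1" using min[OF r] by (auto simp: rising_def)
    then have n: "0 < noise G ?a" "0 < noise G ?b" "0 < noise G ?c"
      using s r \<open>q \<le> q0\<close> by (auto intro!: noise_pos)
    have "weight G ?b / (y + noise G ?b) \<le> weight G ?a / (y + noise G ?a)"
      using q(2) \<open>s \<noteq> 1\<close> n y0 by (simp add: rising_def Let_def field_simps)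
    moreover have "weight G ?c / (y + noise G ?c) < weight G ?b / (y + noise G ?b)"
      using min[OF r] \<open>s \<noteq> 1\<close> n y0 by (simp add: rising_def Let_def field_simps)
    ultimately have "weight G ?c / (y + noise G ?c) \<le> weight G ?a / (y + noise G ?a)" by simp
    then show ?thesis using n y0 by (simp add: rising_def Let_def field_simps)
  qed
  have anti: "x l \<le> x s" if "s \<le> l" for l
    using that
  proof (induction l rule: dec_induct)
    case (step n)
    then show ?case using dec[of n] by simp
  qed simp
  have "(\<Sum>l = s..q. f_term G l l (x l)) \<le> f_term G s q (x s)"
    using q(1)
  proof (induction s rule: inc_induct)
    case base
    show ?case by simp
  next
    case (step t)
    have "(\<Sum>l = t..q. f_term G l l (x l)) =
        f_term G t t (x t) + (\<Sum>l = Suc t..q. f_term G l l (x l))"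
      using step by (subst sum.atLeast_Suc_atMost) auto
    also have "\<dots> \<le> f_term G t t (x t) + f_term G (Suc t) q (x (Suc t))"
      using step by simp
    also have "f_term G (Suc t) q (x (Suc t)) \<le> f_term G (Suc t) q (x t)"
    proof -
      have "rising G (Suc t) q (x t)"
        using rising_downward[OF sub[of t], of "x t"] step s \<open>q \<le> q0\<close> anti[of t] \<open>x s \<le> y\<close>
          nonneg[of t] by simp
      then show ?thesis
        using f_term_mono[of "Suc t" q "x t" "x (Suc t)"] step s \<open>q \<le> q0\<close> dec[of t]
          nonneg[of "Suc t"] by simp
    qed
    also have "f_term G t t (x t) + f_term G (Suc t) q (x t) = f_term G t q (x t)"
      using f_term_split[of t t q G "x t"] step s by simp
    finally show ?case by simp
  qed
  also have "\<dots> \<le> f_term G s q y"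
    using f_term_mono[OF q(2), of "x s"] q s \<open>q \<le> q0\<close> nonneg[of s] \<open>x s \<le> y\<close> by simp
  finally show ?thesis using q(1) \<open>q \<le> q0\<close> by auto
qed

text \<open>
  The second exchange lemma: the powers above \<open>y\<close> are lowered one block after the other, each block
  \<open>s, \<dots>, q\<close> to the power at position \<open>q + 1\<close>, and finally \<open>s, \<dots>, r\<close> to \<open>y\<close>.
\<close>

lemma lower_to:
  assumes falling: "\<And>q. s \<le> q \<Longrightarrow> q \<le> r \<Longrightarrow> falling G s q y" and s: "1 \<le> s" "s \<le> r" "r \<le> K"
    and dec: "\<And>l. s \<le> l \<Longrightarrow> x (l + 1) \<le> x l" and ge: "\<And>l. s \<le> l \<Longrightarrow> l \<le> r \<Longrightarrow> y \<le> x l" and "0 \<le> y"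
  shows "(\<Sum>l = s..r. f_term G l l (x l)) \<le> f_term G s r y"
proof -
  have "(\<Sum>l = s..q. f_term G l l (x l)) \<le> f_term G s q (x q)" if "s \<le> q" "q \<le> r" for q
    using that
  proof (induction q rule: dec_induct)
    case base
    show ?case by simp
  next
    case (step q)
    have "falling G s q (x (Suc q))"
      using falling_upward[OF falling[of q], of "x (Suc q)"] step s ge[of "Suc q"] \<open>0 \<le> y\<close> by simp
    then have "f_term G s q (x q) \<le> f_term G s q (x (Suc q))"
      using f_term_antimono[of s q "x (Suc q)" "x q"] step s dec[of q] ge[of "Suc q"] \<open>0 \<le> y\<close>
      by simp
    then show ?case using step s f_term_split[of s q "Suc q" G "x (Suc q)"] by simp
  qed
  from this[of r] show ?thesis
    using f_term_antimono[OF falling[of r], of "x r"] s ge[of r] \<open>0 \<le> y\<close> by simp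
qed

end

section \<open>Reasoning about programs with an operation count\<close>

text \<open>
  \<open>runs p B Q\<close> says that \<open>p\<close> terminates after at most \<open>B\<close> operations with a result satisfying \<open>Q\<close>.
\<close>

definition runs :: "'a prog \<Rightarrow> nat \<Rightarrow> ('a \<Rightarrow> bool) \<Rightarrow> bool" where
  "runs p B Q \<longleftrightarrow> (\<exists>a n. p = Done a n \<and> n \<le> B \<and> Q a)"

lemma runs_mono: "runs p B Q \<Longrightarrow> B \<le> B' \<Longrightarrow> (\<And>a. Q a \<Longrightarrow> Q' a) \<Longrightarrow> runs p B' Q'"
  by (auto simp: runs_def)

lemma runsD: "runs p B Q \<Longrightarrow> p \<noteq> Diverge \<and> cost p \<le> B \<and> Q (result p)"
  by (auto simp: runs_def)

lemma runs_charge: "c \<le> B \<Longrightarrow> Q a \<Longrightarrow> runs (charge c a) B Q"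
  by (simp add: runs_def charge_def)

lemma runs_bind:
  assumes "runs p B Q" "\<And>a. Q a \<Longrightarrow> runs (q a) B' Q'" "B + B' \<le> C"
  shows "runs (p \<bind> q) C Q'"
proof -
  obtain a n where a: "p = Done a n" "n \<le> B" "Q a" using assms(1) by (auto simp: runs_def)
  obtain b n' where "q a = Done b n'" "n' \<le> B'" "Q' b"
    using assms(2)[OF a(3)] by (auto simp: runs_def)
  then show ?thesis using a assms(3) by (auto simp: runs_def bind_prog_def)
qed

lemma runs_charge_bind:
  assumes "c \<le> C" "runs (q a) (C - c) Q"
  shows "runs (charge c a \<bind> q) C Q"
  by (rule runs_bind[of _ c "\<lambda>b. b = a"]) (use assms in \<open>auto intro: runs_charge\<close>)

lemma runs_for_each:
  assumes "Inv [] s"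
    and "\<And>pre i post s. is = pre @ i # post \<Longrightarrow> Inv pre s \<Longrightarrow> runs (body i s) B (Inv (pre @ [i]))"
    and "length is * B \<le> C"
    and "\<And>s. Inv is s \<Longrightarrow> Q s"
  shows "runs (for_each is body s) C Q"
proof -
  have "runs (for_each post body s) (length post * B) (Inv is)" if "is = pre @ post" "Inv pre s"
    for pre post s
    using that
  proof (induction post arbitrary: pre s)
    case Nil
    then show ?case by (auto intro: runs_charge)
  next
    case (Cons i post)
    have "runs (body i s) B (Inv (pre @ [i]))" using assms(2) Cons.prems by blast
    then show ?case
      unfolding for_each.simps
      by (rule runs_bind[where B' = "length post * B"])
        (use Cons.prems Cons.IH[of "pre @ [i]"] in simp_all)
  qed
  from this[of "[]" "is" s] have "runs (for_each is body s) (length is * B) (Inv is)"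
    using assms(1) by simp
  then show ?thesis using assms(3,4) by (rule runs_mono)
qed

lemma bind_assoc: "((p \<bind> q) \<bind> r) = (p \<bind> (\<lambda>a. q a \<bind> r))" for p :: "'a prog"
  by (auto simp: bind_prog_def split: prog.splits)

lemma for_each_append: "for_each (xs @ ys) body s = (for_each xs body s \<bind> for_each ys body)"
  by (induction xs arbitrary: s) (auto simp: bind_assoc charge_def bind_prog_def split: prog.splits)

section \<open>The recursion satisfied by the tables\<close>

text \<open>
  The three table values at an index, and the value that the recursion prescribes for them:
  \<open>step_entry\<close> for \<open>m \<ge> 1\<close> and \<open>i < K\<close>, the initial values in \<open>entry_ok\<close> otherwise.
\<close>

definition entry :: "tables \<Rightarrow> index \<Rightarrow> real \<times> real \<times> index option" where
  "entry T k = (tab_V T k, tab_X T k, tab_U T k)"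

lemma entry_store:
  "entry (store k v x u T) k' = (if k' = k then (v, x, u) else entry T k')"
  by (simp add: entry_def store_def)

definition step_entry :: "subcarrier \<Rightarrow> real \<Rightarrow> tables \<Rightarrow> index \<Rightarrow> real \<times> real \<times> index option" where
  "step_entry G P T = (\<lambda>(m, j, i).
     let x = argmax_f G j i P; act = (m - 1, i + 1, i + 1); inact = (m, j, i + 1);
         v = f_term G j i x + tab_V T act in
     if v > tab_V T inact \<and> x > tab_X T act then (v, x, Some act)
     else (tab_V T inact, tab_X T inact, Some inact))"

definition entry_ok :: "subcarrier \<Rightarrow> real \<Rightarrow> tables \<Rightarrow> index \<Rightarrow> bool" where
  "entry_ok G P T = (\<lambda>(m, j, i).
     entry T (m, j, i) =
       (let K = num_users G; x = argmax_f G j K P in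
        if m = 0 then (f_term G j K 0, 0, None)
        else if i = K then (f_term G j K x, x, None)
        else step_entry G P T (m, j, i)))"

text \<open>
  An entry with last component \<open>i'\<close> depends only on entries with last component \<open>i' + 1\<close>; storing a
  value at \<open>i \<le> i'\<close> does not disturb it.
\<close>

lemma step_entry_store:
  assumes "i \<le> i'"
  shows "step_entry G P (store (m, j, i) v x u T) (m', j', i') = step_entry G P T (m', j', i')"
proof -
  have "tab_V (store (m, j, i) v x u T) (a, b, i' + 1) = tab_V T (a, b, i' + 1)"
    "tab_X (store (m, j, i) v x u T) (a, b, i' + 1) = tab_X T (a, b, i' + 1)" for a b
    using assms by (simp_all add: store_def)
  then show ?thesis unfolding step_entry_def Let_def by simp
qed

text \<open>
  The recursion holds at every index that the algorithm fills.
\<close>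

definition dp_table :: "subcarrier \<Rightarrow> nat \<Rightarrow> real \<Rightarrow> tables \<Rightarrow> bool" where
  "dp_table G M P T \<longleftrightarrow>
     (\<forall>m j i. m \<le> M \<and> 1 \<le> j \<and> j \<le> i \<and> i \<le> num_users G \<longrightarrow> entry_ok G P T (m, j, i))"

lemma entry_ok_store_other:
  assumes "entry_ok G P T (m', j', i')" "(m', j', i') \<noteq> (m, j, i)"
    "m' = 0 \<or> i' = num_users G \<or> i \<le> i'"
  shows "entry_ok G P (store (m, j, i) v x u T) (m', j', i')"
  using assms(1,3) unfolding entry_ok_def Let_def prod.case entry_store if_not_P[OF assms(2)]
  by (metis step_entry_store)

lemma entry_ok_store_zero:
  "num_users G = K \<Longrightarrow> entry_ok G P (store (0, j, i) (f_term G j K 0) 0 None T) (0, j, i)"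
  by (simp add: entry_ok_def entry_store)

lemma entry_ok_store_last:
  assumes "num_users G = K" "1 \<le> m"
  shows "entry_ok G P (store (m, j, K) (f_term G j K (argmax_f G j K P)) (argmax_f G j K P) None T)
    (m, j, K)"
  using assms by (simp add: entry_ok_def entry_store Let_def)

lemma entry_ok_store_step:
  assumes "1 \<le> m" "i \<noteq> num_users G" "step_entry G P T (m, j, i) = (v, x, u)"
  shows "entry_ok G P (store (m, j, i) v x u T) (m, j, i)"
  using assms by (simp add: entry_ok_def entry_store step_entry_store)

text \<open>
  The loop invariant: the recursion holds at the indices \<open>D\<close> filled so far.
\<close>

definition ok_on :: "subcarrier \<Rightarrow> real \<Rightarrow> index set \<Rightarrow> tables \<Rightarrow> bool" where
  "ok_on G P D T \<longleftrightarrow> (\<forall>k\<in>D. entry_ok G P T k)"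

lemma ok_on_subset: "ok_on G P D T \<Longrightarrow> D' \<subseteq> D \<Longrightarrow> ok_on G P D' T"
  by (auto simp: ok_on_def)

lemma ok_on_store:
  assumes "ok_on G P D T" "\<And>m' j' i'. (m', j', i') \<in> D \<Longrightarrow> m' = 0 \<or> i' = num_users G \<or> i \<le> i'"
    and "entry_ok G P (store (m, j, i) v x u T) (m, j, i)" "D' \<subseteq> insert (m, j, i) D"
  shows "ok_on G P D' (store (m, j, i) v x u T)"
  unfolding ok_on_def
proof
  fix k assume "k \<in> D'"
  obtain m' j' i' where k: "k = (m', j', i')" by (cases k)
  show "entry_ok G P (store (m, j, i) v x u T) k"
  proof (cases "k = (m, j, i)")
    case False
    then have "k \<in> D" using \<open>k \<in> D'\<close> assms(4) by blast
    then show ?thesis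
      using entry_ok_store_other[of G P T m' j' i' m j i v x u] False assms(1,2)
      unfolding k ok_on_def by blast
  qed (use assms(3) in simp)
qed

text \<open>
  The indices with \<open>m = 0\<close> and, for \<open>m \<in> ms\<close>, those with \<open>i = K\<close>; they are filled initially.
\<close>

definition boundary :: "nat \<Rightarrow> nat set \<Rightarrow> index set" where
  "boundary K ms = {(m, j, i). 1 \<le> j \<and> j \<le> i \<and> i \<le> K \<and> (m = 0 \<or> (m \<in> ms \<and> i = K))}"

lemma runs_scus_init:
  assumes "num_users G = K"
  shows "runs (scus_init G M P T0) (K * (K * 9) + M * (K * 18)) (ok_on G P (boundary K {1..M}))"
proof -
  have 1: "runs (for_each [1..<K + 1] (\<lambda>j. for_each [j..<K + 1] (\<lambda>i T. do {
          v \<leftarrow> eval_f G j K 0;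
          return (store (0, j, i) v 0 None T)
        })) T0) (K * (K * 9)) (ok_on G P (boundary K {}))" (is "runs (for_each _ ?body _) _ _")
  proof (rule runs_for_each[where B = "K * 9"
          and Inv = "\<lambda>js. ok_on G P {(m, j, i). m = 0 \<and> j \<in> set js \<and> j \<le> i \<and> i \<le> K}"])
    fix pre j post T
    assume split: "[1..<K + 1] = pre @ j # post"
      and inv: "ok_on G P {(m, j, i). m = 0 \<and> j \<in> set pre \<and> j \<le> i \<and> i \<le> K} T"
    have "j \<in> set [1..<K + 1]" using split by simp
    then have j: "1 \<le> j" "j \<le> K" by auto
    show "runs (?body j T) (K * 9)
        (ok_on G P {(m, j', i). m = 0 \<and> j' \<in> set (pre @ [j]) \<and> j' \<le> i \<and> i \<le> K})"
    proof (rule runs_for_each[where B = 9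
          and Inv = "\<lambda>is. ok_on G P ({(m, j, i). m = 0 \<and> j \<in> set pre \<and> j \<le> i \<and> i \<le> K} \<union>
             {(m, j', i). m = 0 \<and> j' = j \<and> i \<in> set is})"])
      fix pre' i post' T
      assume "ok_on G P ({(m, j, i). m = 0 \<and> j \<in> set pre \<and> j \<le> i \<and> i \<le> K} \<union>
             {(m, j', i). m = 0 \<and> j' = j \<and> i \<in> set pre'}) T"
      note inv' = this
      show "runs (eval_f G j K 0 \<bind> (\<lambda>v. return (store (0, j, i) v 0 None T))) 9
          (ok_on G P ({(m, j, i). m = 0 \<and> j \<in> set pre \<and> j \<le> i \<and> i \<le> K} \<union>
             {(m, j', i'). m = 0 \<and> j' = j \<and> i' \<in> set (pre' @ [i])}))"
        unfolding eval_f_def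
        by (intro runs_charge_bind runs_charge) (auto intro!: ok_on_store[OF inv'] entry_ok_store_zero assms)
    next
      show "ok_on G P ({(m, j, i). m = 0 \<and> j \<in> set pre \<and> j \<le> i \<and> i \<le> K} \<union>
             {(m, j', i). m = 0 \<and> j' = j \<and> i \<in> set []}) T"
        by (rule ok_on_subset[OF inv]) auto
      show "ok_on G P {(m, j', i). m = 0 \<and> j' \<in> set (pre @ [j]) \<and> j' \<le> i \<and> i \<le> K} T"
        if "ok_on G P ({(m, j, i). m = 0 \<and> j \<in> set pre \<and> j \<le> i \<and> i \<le> K} \<union>
             {(m, j', i). m = 0 \<and> j' = j \<and> i \<in> set [j..<K + 1]}) T" for T
        by (rule ok_on_subset[OF that]) auto
    qed (use j in auto)
  next
    show "ok_on G P (boundary K {}) T"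
      if "ok_on G P {(m, j, i). m = 0 \<and> j \<in> set [1..<K + 1] \<and> j \<le> i \<and> i \<le> K} T" for T
      by (rule ok_on_subset[OF that]) (auto simp: boundary_def)
  qed (auto simp: ok_on_def)
  have 2: "runs (for_each [1..<M + 1] (\<lambda>m. for_each [1..<K + 1] (\<lambda>j T. do {
          x \<leftarrow> eval_argmax G j K P;
          v \<leftarrow> eval_f G j K x;
          return (store (m, j, K) v x None T)
        })) T1) (M * (K * 18)) (ok_on G P (boundary K {1..M}))"
    (is "runs (for_each _ ?body _) _ _")
    if T1: "ok_on G P (boundary K {}) T1" for T1
  proof (rule runs_for_each[where B = "K * 18"
          and Inv = "\<lambda>ms. ok_on G P (boundary K (set ms))"])
    fix pre m post T
    assume split: "[1..<M + 1] = pre @ m # post" and inv: "ok_on G P (boundary K (set pre)) T"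
    have "m \<in> set [1..<M + 1]" using split by simp
    then have m: "1 \<le> m" by auto
    show "runs (?body m T) (K * 18) (ok_on G P (boundary K (set (pre @ [m]))))"
    proof (rule runs_for_each[where B = 18
          and Inv = "\<lambda>js. ok_on G P (boundary K (set pre) \<union>
             {(m', j, i). m' = m \<and> j \<in> set js \<and> i = K})"])
      fix pre' j post' T
      assume "ok_on G P (boundary K (set pre) \<union>
             {(m', j, i). m' = m \<and> j \<in> set pre' \<and> i = K}) T"
      note inv' = this
      show "runs (eval_argmax G j K P \<bind> (\<lambda>x. eval_f G j K x \<bind>
            (\<lambda>v. return (store (m, j, K) v x None T)))) 18
          (ok_on G P (boundary K (set pre) \<union> {(m', j', i). m' = m \<and> j' \<in> set (pre' @ [j]) \<and> i = K}))"
        unfolding eval_f_def eval_argmax_def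
        by (intro runs_charge_bind runs_charge)
          (use m in \<open>auto intro!: ok_on_store[OF inv'] entry_ok_store_last simp: assms boundary_def\<close>)
    next
      show "ok_on G P (boundary K (set pre) \<union> {(m', j, i). m' = m \<and> j \<in> set [] \<and> i = K}) T"
        by (rule ok_on_subset[OF inv]) auto
      show "ok_on G P (boundary K (set (pre @ [m]))) T"
        if "ok_on G P (boundary K (set pre) \<union>
            {(m', j, i). m' = m \<and> j \<in> set [1..<K + 1] \<and> i = K}) T" for T
        by (rule ok_on_subset[OF that]) (auto simp: boundary_def)
    qed auto
  next
    show "ok_on G P (boundary K (set [])) T1"
      by (rule ok_on_subset[OF T1]) (auto simp: boundary_def)
    show "ok_on G P (boundary K {1..M}) T" if "ok_on G P (boundary K (set [1..<M + 1])) T" for T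
      by (rule ok_on_subset[OF that]) (auto simp: boundary_def)
  qed auto
  show ?thesis
    unfolding scus_init_def Let_def assms by (rule runs_bind[OF 1 2]) auto
qed

lemma runs_scus_step:
  assumes "ok_on G P D T" "\<And>m' j' i'. (m', j', i') \<in> D \<Longrightarrow> m' = 0 \<or> i' = num_users G \<or> i \<le> i'"
    and "1 \<le> m" "i \<noteq> num_users G" "D' \<subseteq> insert (m, j, i) D"
  shows "runs (scus_step G P i m j T) 21 (ok_on G P D')"
proof -
  define x where "x = argmax_f G j i P"
  define v where "v = f_term G j i x + tab_V T (m - 1, i + 1, i + 1)"
  define c where "c \<longleftrightarrow> v > tab_V T (m, j, i + 1) \<and> x > tab_X T (m - 1, i + 1, i + 1)"
  have "step_entry G P T (m, j, i) = (if c then (v, x, Some (m - 1, i + 1, i + 1))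
      else (tab_V T (m, j, i + 1), tab_X T (m, j, i + 1), Some (m, j, i + 1)))"
    by (simp only: step_entry_def Let_def prod.case x_def v_def c_def)
  then have ok: "ok_on G P D' (if c then store (m, j, i) v x (Some (m - 1, i + 1, i + 1)) T
      else store (m, j, i) (tab_V T (m, j, i + 1)) (tab_X T (m, j, i + 1)) (Some (m, j, i + 1)) T)"
    by (cases c) (simp_all only: if_True if_False,
      (intro ok_on_store[OF assms(1,2)] entry_ok_store_step assms; assumption)+)
  show ?thesis
    unfolding scus_step_def eval_f_def eval_argmax_def Let_def
    by (intro runs_charge_bind runs_charge) (fact ok[unfolded c_def v_def x_def] | simp)+
qed

lemma rev_upt_split:
  assumes "rev [1..<K] = pre @ i # post" "i' \<in> set pre"
  shows "i < i'"
proof -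
  have "sorted_wrt (>) (rev [1..<K])" by (simp add: sorted_wrt_rev)
  then show ?thesis using assms(2) unfolding assms(1) by (auto simp: sorted_wrt_append)
qed

lemma runs_scus_tables:
  assumes K: "num_users G = K"
  shows "runs (scus_tables G M P) (K * (K * 9) + M * (K * 18) + K * (M * (K * 21))) (dp_table G M P)"
proof -
  define below :: "nat set \<Rightarrow> index set"
    where "below I = {(m, j, i). 1 \<le> j \<and> j \<le> i \<and> 1 \<le> m \<and> m \<le> M \<and> i \<in> I}" for I
  have step: "runs (for_each [1..<M + 1] (\<lambda>m.
         for_each (rev [1..<i + 1]) (\<lambda>j. scus_step G P i m j)) T) (M * (K * 21))
        (ok_on G P (boundary K {1..M} \<union> below (set (pre @ [i]))))"
    (is "runs (for_each _ ?body _) _ _")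
    if split: "rev [1..<K] = pre @ i # post" and inv: "ok_on G P (boundary K {1..M} \<union> below (set pre)) T"
    for pre i post T
  proof -
    have "i \<in> set (rev [1..<K])" using split by simp
    then have i: "1 \<le> i" "i < K" by auto
    have pre: "i \<le> i'" if "i' \<in> set pre" for i' using rev_upt_split[OF split that] by simp
    let ?D = "\<lambda>ms. boundary K {1..M} \<union> below (set pre) \<union>
      {(m, j, i'). i' = i \<and> m \<in> ms \<and> 1 \<le> j \<and> j \<le> i}"
    show ?thesis
    proof (rule runs_for_each[where B = "K * 21"
          and Inv = "\<lambda>ms. ok_on G P (?D (set ms))"])
      fix pre1 m post1 T
      assume split1: "[1..<M + 1] = pre1 @ m # post1" and inv1: "ok_on G P (?D (set pre1)) T"
      have "m \<in> set [1..<M + 1]" using split1 by simp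
      then have m: "1 \<le> m" by auto
      show "runs (?body m T) (K * 21) (ok_on G P (?D (set (pre1 @ [m]))))"
      proof (rule runs_for_each[where B = 21
          and Inv = "\<lambda>js. ok_on G P (?D (set pre1) \<union> {(m', j, i'). i' = i \<and> m' = m \<and> j \<in> set js})"])
        fix pre2 j post2 T
        assume "ok_on G P (?D (set pre1) \<union> {(m', j, i'). i' = i \<and> m' = m \<and> j \<in> set pre2}) T"
        then show "runs (scus_step G P i m j T) 21
          (ok_on G P (?D (set pre1) \<union> {(m', j', i'). i' = i \<and> m' = m \<and> j' \<in> set (pre2 @ [j])}))"
        proof (rule runs_scus_step)
          show "m' = 0 \<or> i' = num_users G \<or> i \<le> i'"
            if "(m', j', i') \<in> ?D (set pre1) \<union> {(m', j, i'). i' = i \<and> m' = m \<and> j \<in> set pre2}"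
            for m' j' i'
            using that pre by (auto simp: K boundary_def below_def)
        qed (use m i K in auto)
      next
        show "length (rev [1..<i + 1]) * 21 \<le> K * 21" using i by simp
        show "ok_on G P (?D (set pre1) \<union> {(m', j, i'). i' = i \<and> m' = m \<and> j \<in> set []}) T"
          by (rule ok_on_subset[OF inv1]) auto
        show "ok_on G P (?D (set (pre1 @ [m]))) T"
          if "ok_on G P (?D (set pre1) \<union>
            {(m', j, i'). i' = i \<and> m' = m \<and> j \<in> set (rev [1..<i + 1])}) T" for T
          by (rule ok_on_subset[OF that]) auto
      qed
    next
      show "ok_on G P (?D (set [])) T"
        by (rule ok_on_subset[OF inv]) auto
      show "ok_on G P (boundary K {1..M} \<union> below (set (pre @ [i]))) T"
        if "ok_on G P (?D (set [1..<M + 1])) T" for T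
        by (rule ok_on_subset[OF that]) (auto simp: below_def)
    qed simp
  qed
  show ?thesis
    unfolding scus_tables_def K
  proof (rule runs_bind[OF runs_scus_init[OF K]])
    fix T assume T: "ok_on G P (boundary K {1..M}) T"
    show "runs (for_each (rev [1..<K]) (\<lambda>i. for_each [1..<M + 1] (\<lambda>m.
         for_each (rev [1..<i + 1]) (\<lambda>j. scus_step G P i m j))) T) (K * (M * (K * 21))) (dp_table G M P)"
    proof (rule runs_for_each[where B = "M * (K * 21)"
          and Inv = "\<lambda>is. ok_on G P (boundary K {1..M} \<union> below (set is))"])
      show "length (rev [1..<K]) * (M * (K * 21)) \<le> K * (M * (K * 21))"
        by (intro mult_right_mono) auto
      show "dp_table G M P T" if "ok_on G P (boundary K {1..M} \<union> below (set (rev [1..<K]))) T" for T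
        using that unfolding ok_on_def dp_table_def boundary_def below_def K
        by (auto simp: Suc_le_eq)
      show "ok_on G P (boundary K {1..M} \<union> below (set [])) T"
        by (rule ok_on_subset[OF T]) (auto simp: below_def)
    qed (use step in auto)
  qed auto
qed

section \<open>Retrieval\<close>

text \<open>
  \<open>patch j q c x\<close> is \<open>x\<close> overwritten with the constant \<open>c\<close> on the block \<open>j, \<dots>, q\<close>.
\<close>

definition patch :: "nat \<Rightarrow> nat \<Rightarrow> real \<Rightarrow> (nat \<Rightarrow> real) \<Rightarrow> nat \<Rightarrow> real" where
  "patch j q c x = (\<lambda>l. if j \<le> l \<and> l \<le> q then c else x l)"

text \<open>
  \<open>decodes T k s n\<close> means that following the links \<open>tab_U\<close> from \<open>k\<close> to the end takes \<open>n\<close> passes and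
  describes the vector \<open>s\<close>.  Here the vector is built from the end of the chain of links, whereas
  the loop overwrites blocks from its beginning.
\<close>

inductive decodes :: "tables \<Rightarrow> index \<Rightarrow> (nat \<Rightarrow> real) \<Rightarrow> nat \<Rightarrow> bool" for T where
  stop: "tab_U T (m, j, i) = None \<Longrightarrow>
    decodes T (m, j, i) (patch j i (tab_X T (m, j, i)) (\<lambda>_. 0)) 1"
| act: "tab_U T (m, j, i) = Some (m', i + 1, i + 1) \<Longrightarrow> decodes T (m', i + 1, i + 1) s n \<Longrightarrow> j \<le> i \<Longrightarrow>
    decodes T (m, j, i) (patch j i (tab_X T (m, j, i)) s) (n + 1)"
| inact: "tab_U T (m, j, i) = Some (m, j, i + 1) \<Longrightarrow> decodes T (m, j, i + 1) s n \<Longrightarrow>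
    decodes T (m, j, i) s (n + 1)"

text \<open>
  The retrieval loop started in an arbitrary state, which the induction over \<open>decodes\<close> needs.
\<close>

definition retrieve_loop ::
  "tables \<Rightarrow> index option \<times> (nat \<Rightarrow> real) \<times> nat \<Rightarrow> (index option \<times> (nat \<Rightarrow> real) \<times> nat) option" where
  "retrieve_loop T =
     while_option (\<lambda>(u, x, c). u \<noteq> None)
        (\<lambda>(u, x, c). case the u of (m, j, i) \<Rightarrow>
           (tab_U T (m, j, i), \<lambda>l. if j \<le> l \<and> l \<le> i then tab_X T (m, j, i) else x l, c + 1))"

lemma retrieve_loop_None: "retrieve_loop T (None, x, c) = Some (None, x, c)"
  unfolding retrieve_loop_def by (subst while_option_unfold) simp

lemma retrieve_loop_Some:
  "retrieve_loop T (Some (m, j, i), x, c) = retrieve_loop T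
     (tab_U T (m, j, i), \<lambda>l. if j \<le> l \<and> l \<le> i then tab_X T (m, j, i) else x l, c + 1)"
  unfolding retrieve_loop_def by (subst while_option_unfold) simp

lemma decodes_below: "decodes T (m, j, i) s n \<Longrightarrow> l < j \<Longrightarrow> s l = 0"
  by (induction "(m, j, i)" s n arbitrary: m j i rule: decodes.induct) (auto simp: patch_def)

text \<open>
  The components in \<open>j, \<dots>, i\<close> may already be set, since a link to \<open>(m, j, i + 1)\<close> overwrites them;
  those beyond \<open>i\<close> must still be zero, since the last block need not reach \<open>K\<close>.
\<close>

lemma retrieve_loop_decodes:
  assumes "decodes T (m, j, i) s n" "\<And>l. i < l \<Longrightarrow> x l = 0"
  shows "retrieve_loop T (Some (m, j, i), x, c) =
     Some (None, \<lambda>l. if j \<le> l then s l else x l, c + n)"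
  using assms
proof (induction "(m, j, i)" s n arbitrary: m j i x c rule: decodes.induct)
  case (stop m j i)
  then show ?case by (auto simp: retrieve_loop_Some retrieve_loop_None patch_def fun_eq_iff)
next
  case (act m j i m' s n)
  show ?case
    by (subst retrieve_loop_Some, subst act(1), subst act(3))
      (use act(4-5) in \<open>auto simp: patch_def fun_eq_iff\<close>)
next
  case (inact m j i s n)
  show ?case
    by (subst retrieve_loop_Some, subst inact(1), subst inact(3))
      (use inact(4) in \<open>auto simp: fun_eq_iff\<close>)
qed

lemma retrieve_decodes:
  assumes "decodes T k s n"
  shows "retrieve T k = Done s n"
proof -
  obtain m j i where k: "k = (m, j, i)" by (cases k)
  have "retrieve_loop T (Some k, \<lambda>_. 0, 0) = Some (None, s, n)"
    using retrieve_loop_decodes[of T m j i s n "\<lambda>_. 0" 0] assms decodes_below[of T m j i s n]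
    by (auto simp: k fun_eq_iff)
  then show ?thesis unfolding retrieve_def retrieve_loop_def[symmetric] by simp
qed

section \<open>Optimality of the table entries\<close>

text \<open>
  The vector is nonincreasing from position \<open>s\<close> on and vanishes beyond \<open>K\<close>.  With the convention
  \<open>x (K + 1) = 0\<close> the last position needs no special treatment, and the powers are nonnegative.
\<close>

definition chain :: "subcarrier \<Rightarrow> nat \<Rightarrow> (nat \<Rightarrow> real) \<Rightarrow> bool" where
  "chain G s x \<longleftrightarrow> (\<forall>l\<ge>s. x (l + 1) \<le> x l) \<and> (\<forall>l>num_users G. x l = 0)"

text \<open>
  The active users at the positions \<open>s, \<dots>, K\<close>, under the same convention.
\<close>

definition drops :: "subcarrier \<Rightarrow> nat \<Rightarrow> (nat \<Rightarrow> real) \<Rightarrow> nat set" where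
  "drops G s x = {l \<in> {s..num_users G}. x (l + 1) < x l}"

lemma finite_drops [simp]: "finite (drops G s x)"
  by (simp add: drops_def)

lemma drops_antimono: "s \<le> t \<Longrightarrow> drops G t x \<subseteq> drops G s x"
  by (auto simp: drops_def)

lemma card_drops_antimono: "s \<le> t \<Longrightarrow> card (drops G t x) \<le> card (drops G s x)"
  by (simp add: card_mono drops_antimono)

lemma card_drops_less:
  assumes "r \<in> drops G s x" "r < t"
  shows "card (drops G t x) < card (drops G s x)"
proof (rule psubset_card_mono)
  have "drops G t x \<subseteq> drops G s x" using assms by (intro drops_antimono) (auto simp: drops_def)
  moreover have "r \<notin> drops G t x" using assms by (auto simp: drops_def)
  ultimately show "drops G t x \<subset> drops G s x" using assms by blast
qed simp

lemma chain_mono: "chain G s x \<Longrightarrow> s \<le> t \<Longrightarrow> chain G t x"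
  by (simp add: chain_def)

lemma chain_antimono:
  assumes "chain G s x" "s \<le> l" "l \<le> l'"
  shows "x l' \<le> x l"
  using assms(3)
proof (induction l' rule: dec_induct)
  case (step n)
  then have "x (n + 1) \<le> x n" using assms(1,2) by (simp add: chain_def)
  then show ?case using step by simp
qed simp

lemma chain_nonneg:
  assumes "chain G s x" "s \<le> l"
  shows "0 \<le> x l"
  using chain_antimono[OF assms, of "max l (num_users G + 1)"] assms(1) by (simp add: chain_def)

lemma chain_no_drops:
  assumes "chain G s x" "drops G s x = {}" "s \<le> l"
  shows "x l = 0"
proof (cases "l \<le> num_users G + 1")
  case True
  then show ?thesis using assms(3)
  proof (induction l rule: inc_induct)
    case base
    then show ?case using assms(1) by (simp add: chain_def)
  next
    case (step n)
    have "n \<notin> drops G s x" using assms(2) by simp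
    then have "x n \<le> x (n + 1)" using step by (auto simp: drops_def)
    then show ?case using step chain_nonneg[OF assms(1) \<open>s \<le> n\<close>] by simp
  qed
qed (use assms in \<open>simp add: chain_def\<close>)

lemma chain_patch:
  assumes "chain G (q + 1) x" "q \<le> num_users G" "x (q + 1) \<le> c"
  shows "chain G j (patch j q c x)"
  unfolding chain_def
proof safe
  fix l assume "j \<le> l"
  have "l = q \<or> l < q \<or> q + 1 \<le> l" by linarith
  then show "patch j q c x (l + 1) \<le> patch j q c x l"
    using assms \<open>j \<le> l\<close> by (auto simp: patch_def chain_def)
qed (use assms in \<open>auto simp: patch_def chain_def\<close>)

lemma drops_patch:
  assumes "j \<le> s"
  shows "drops G s (patch j q c x) \<subseteq> insert q (drops G (q + 1) x)"
  using assms by (auto simp: drops_def patch_def split: if_splits)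

lemma card_drops_patch:
  assumes "j \<le> s"
  shows "card (drops G s (patch j q c x)) \<le> Suc (card (drops G (q + 1) x))"
proof -
  have "card (drops G s (patch j q c x)) \<le> card (insert q (drops G (q + 1) x))"
    using drops_patch[OF assms] by (intro card_mono) auto
  also have "\<dots> \<le> Suc (card (drops G (q + 1) x))" by (simp add: card_insert_if)
  finally show ?thesis .
qed

lemma tail_patch:
  assumes "1 \<le> j" "j \<le> q" "q \<le> num_users G"
  shows "tail G j (patch j q c x) = f_term G j q c + tail G (q + 1) x"
  using tail_block[of j q G "patch j q c x" c] assms
    tail_cong[of "q + 1" G "patch j q c x" x] by (simp add: patch_def)

text \<open>
  The competitors for the entry \<open>(m, j, i)\<close>.  As \<open>x\<close> is nonincreasing, \<open>x i = x j\<close> says that it is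
  constant on \<open>j, \<dots>, i\<close>.
\<close>

definition admissible :: "subcarrier \<Rightarrow> real \<Rightarrow> index \<Rightarrow> (nat \<Rightarrow> real) \<Rightarrow> bool" where
  "admissible G P = (\<lambda>(m, j, i) x.
     chain G j x \<and> x j \<le> P \<and> x i = x j \<and> card (drops G i x) \<le> m)"

lemma admissible_const:
  assumes "admissible G P (m, j, i) x" "j \<le> l" "l \<le> i"
  shows "x l = x j"
  using chain_antimono[of G j x j l] chain_antimono[of G j x l i] assms
  by (simp add: admissible_def)

lemma tail_admissible:
  assumes "admissible G P (m, j, i) x" "1 \<le> j" "j \<le> i" "i \<le> num_users G"
  shows "tail G j x = f_term G j i (x j) + tail G (i + 1) x"
proof (rule tail_block)
  show "x l = x j" if "j \<le> l" "l \<le> i" for l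
    using admissible_const[OF assms(1) that] .
qed (use assms in auto)

text \<open>
  The table value at \<open>(m, j, i)\<close> is attained by the retrieved vector and is an upper bound for all
  competitors.  The last clause, that for \<open>m \<ge> 1\<close> the stored power maximizes a block function
  starting at \<open>j\<close>, is what makes \<open>raise_to\<close> applicable in the induction.
\<close>

definition entry_optimal :: "subcarrier \<Rightarrow> real \<Rightarrow> tables \<Rightarrow> index \<Rightarrow> bool" where
  "entry_optimal G P T = (\<lambda>(m, j, i).
     (\<exists>s n. decodes T (m, j, i) s n \<and> n \<le> num_users G - i + 1 \<and> admissible G P (m, j, i) s \<and>
        s j = tab_X T (m, j, i) \<and> tail G j s = tab_V T (m, j, i)) \<and>
     (\<forall>x. admissible G P (m, j, i) x \<longrightarrow> tail G j x \<le> tab_V T (m, j, i)) \<and>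
     (if m = 0 then tab_X T (m, j, i) = 0
      else \<exists>q\<in>{i..num_users G}. tab_X T (m, j, i) = argmax_f G j q P))"

lemma entry_optimalI:
  assumes "decodes T (m, j, i) s n" "n \<le> num_users G - i + 1" "admissible G P (m, j, i) s"
    "s j = tab_X T (m, j, i)" "tail G j s = tab_V T (m, j, i)"
    "\<And>x. admissible G P (m, j, i) x \<Longrightarrow> tail G j x \<le> tab_V T (m, j, i)"
    "m = 0 \<Longrightarrow> tab_X T (m, j, i) = 0"
    "0 < m \<Longrightarrow> \<exists>q\<in>{i..num_users G}. tab_X T (m, j, i) = argmax_f G j q P"
  shows "entry_optimal G P T (m, j, i)"
  unfolding entry_optimal_def prod.case
proof (intro conjI)
  show "\<exists>s n. decodes T (m, j, i) s n \<and> n \<le> num_users G - i + 1 \<and> admissible G P (m, j, i) s \<and>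
      s j = tab_X T (m, j, i) \<and> tail G j s = tab_V T (m, j, i)"
    using assms(1-5) by (intro exI[of _ s] exI[of _ n] conjI)
  show "\<forall>x. admissible G P (m, j, i) x \<longrightarrow> tail G j x \<le> tab_V T (m, j, i)"
    using assms(6) by (intro allI impI)
  show "if m = 0 then tab_X T (m, j, i) = 0
      else \<exists>q\<in>{i..num_users G}. tab_X T (m, j, i) = argmax_f G j q P"
    using assms(7,8) by (cases "m = 0") (simp_all only: if_True if_False, simp)
qed

lemma entry_optimal_solution:
  assumes "entry_optimal G P T (m, j, i)"
  obtains s n where "decodes T (m, j, i) s n" "n \<le> num_users G - i + 1"
    "admissible G P (m, j, i) s" "s j = tab_X T (m, j, i)" "tail G j s = tab_V T (m, j, i)"
  using assms unfolding entry_optimal_def prod.case by blast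

lemma entry_optimal_le:
  assumes "entry_optimal G P T (m, j, i)" "admissible G P (m, j, i) x"
  shows "tail G j x \<le> tab_V T (m, j, i)"
  using assms unfolding entry_optimal_def prod.case by blast

lemma entry_optimal_power:
  assumes "entry_optimal G P T (m, j, i)" "tab_X T (m, j, i) \<noteq> 0 \<or> 0 < m"
  obtains q where "q \<in> {i..num_users G}" "tab_X T (m, j, i) = argmax_f G j q P"
proof (cases "m = 0")
  case True
  have "if m = 0 then tab_X T (m, j, i) = 0
      else \<exists>q\<in>{i..num_users G}. tab_X T (m, j, i) = argmax_f G j q P"
    using assms(1) unfolding entry_optimal_def prod.case by (elim conjE)
  then show ?thesis using True assms(2) by simp
next
  case False
  have "if m = 0 then tab_X T (m, j, i) = 0
      else \<exists>q\<in>{i..num_users G}. tab_X T (m, j, i) = argmax_f G j q P"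
    using assms(1) unfolding entry_optimal_def prod.case by (elim conjE)
  then show ?thesis using False that by (simp only: if_False) blast
qed

context sorted_subcarrier
begin

lemma entry_optimal_zero:
  assumes "entry T (0, j, i) = (f_term G j K 0, 0, None)" "0 \<le> P" "1 \<le> j" "j \<le> i" "i \<le> K"
  shows "entry_optimal G P T (0, j, i)"
proof -
  have T: "tab_V T (0, j, i) = f_term G j K 0" "tab_X T (0, j, i) = 0" "tab_U T (0, j, i) = None"
    using assms(1) by (simp_all add: entry_def)
  have zero: "tail G j (\<lambda>_. 0) = f_term G j K 0"
    using tail_block[of j K G "\<lambda>_. 0" 0] assms by simp
  have dec: "decodes T (0, j, i) (\<lambda>_. 0) 1"
    using decodes.stop[of T 0 j i] T by (simp add: patch_def)
  have adm: "admissible G P (0, j, i) (\<lambda>_. 0)"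
    using assms by (simp add: admissible_def chain_def drops_def)
  have le: "tail G j x \<le> f_term G j K 0" if x: "admissible G P (0, j, i) x" for x
  proof -
    have i: "x l = 0" if "i \<le> l" for l
      using chain_no_drops[of G i x l] x that chain_mono[of G j x i] \<open>j \<le> i\<close>
      by (simp add: admissible_def)
    have "x l = 0" if "j \<le> l" for l
    proof (cases "i \<le> l")
      case False
      then have "x l = x j" "x i = x j"
        using admissible_const[OF x, of l] admissible_const[OF x, of i] that \<open>j \<le> i\<close>
        by simp_all
      then show ?thesis using i[of i] by simp
    qed (use i in simp)
    then show ?thesis using zero tail_cong[of j G x "\<lambda>_. 0"] by simp
  qed
  show ?thesis
  proof (rule entry_optimalI[OF dec _ adm])
    show "tail G j x \<le> tab_V T (0, j, i)" if "admissible G P (0, j, i) x" for x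
      using le[OF that] T by simp
  qed (simp_all add: T zero)
qed

lemma entry_optimal_last:
  assumes "entry T (m, j, K) = (f_term G j K x, x, None)" "x = argmax_f G j K P"
    "0 \<le> P" "1 \<le> j" "j \<le> K" "1 \<le> m"
  shows "entry_optimal G P T (m, j, K)"
proof -
  have T: "tab_V T (m, j, K) = f_term G j K x" "tab_X T (m, j, K) = x" "tab_U T (m, j, K) = None"
    using assms(1) by (simp_all add: entry_def)
  let ?s = "patch j K x (\<lambda>_. 0)"
  have x: "0 \<le> x" "x \<le> P" using argmax_f_range[of P j K] assms by auto
  have dec: "decodes T (m, j, K) ?s 1"
    using decodes.stop[of T m j K] T by simp
  have adm: "admissible G P (m, j, K) ?s"
  proof -
    have "chain G j ?s" using x by (intro chain_patch) (auto simp: chain_def)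
    moreover have "card (drops G K ?s) \<le> 1"
      using card_drops_patch[of j K G K x "\<lambda>_. 0"] assms by (simp add: drops_def)
    ultimately show ?thesis using assms x by (auto simp: admissible_def patch_def)
  qed
  have val: "tail G j ?s = f_term G j K x"
    using tail_patch[of j K G x "\<lambda>_. 0"] assms by simp
  have le: "tail G j y \<le> f_term G j K x" if y: "admissible G P (m, j, K) y" for y
  proof -
    have "0 \<le> y j" "y j \<le> P" using y chain_nonneg by (auto simp: admissible_def)
    then show ?thesis
      using tail_admissible[OF y] f_term_le_argmax[of "y j" P j K] assms by simp
  qed
  show ?thesis
  proof (rule entry_optimalI[OF dec _ adm])
    show "tail G j y \<le> tab_V T (m, j, K)" if "admissible G P (m, j, K) y" for y
      using le[OF that] T by simp
    show "\<exists>q\<in>{K..K}. tab_X T (m, j, K) = argmax_f G j q P" using T assms(2) by simp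
    show "?s j = tab_X T (m, j, K)" using T assms(5) by (simp add: patch_def)
  qed (use val T assms(6) in simp_all)
qed

lemma entry_optimal_step:
  assumes entry: "entry T (m, j, i) = step_entry G P T (m, j, i)"
    and next_block: "entry_optimal G P T (m - 1, i + 1, i + 1)"
    and longer: "entry_optimal G P T (m, j, i + 1)"
    and range: "0 \<le> P" "1 \<le> j" "j \<le> i" "i < K" "1 \<le> m"
  shows "entry_optimal G P T (m, j, i)"
proof -
  define x where "x = argmax_f G j i P"
  define z where "z = tab_X T (m - 1, i + 1, i + 1)"
  define v where "v = f_term G j i x + tab_V T (m - 1, i + 1, i + 1)"
  have x: "0 \<le> x" "x \<le> P" unfolding x_def using argmax_f_range range(1) by blast+
  obtain s n where s: "decodes T (m - 1, i + 1, i + 1) s n" "n \<le> K - (i + 1) + 1"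
      "admissible G P (m - 1, i + 1, i + 1) s" "s (i + 1) = z"
      "tail G (i + 1) s = tab_V T (m - 1, i + 1, i + 1)"
    using entry_optimal_solution[OF next_block] unfolding z_def by blast
  have next_le: "tail G (i + 1) y \<le> tab_V T (m - 1, i + 1, i + 1)"
    if "admissible G P (m - 1, i + 1, i + 1) y" for y
    using entry_optimal_le[OF next_block that] .
  have longer_le: "tail G j y \<le> tab_V T (m, j, i + 1)" if "admissible G P (m, j, i + 1) y" for y
    using entry_optimal_le[OF longer that] .
  \<comment> \<open>A competitor for which \<open>i\<close> is inactive competes for \<open>(m, j, i + 1)\<close>; otherwise its part beyond
    \<open>i\<close> competes for \<open>(m - 1, i + 1, i + 1)\<close>.\<close>
  have merged: "tail G j y \<le> tab_V T (m, j, i + 1)"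
    if y: "admissible G P (m, j, i) y" and eq: "y (i + 1) = y i" for y
  proof (rule longer_le)
    show "admissible G P (m, j, i + 1) y"
      using y eq card_drops_antimono[of i "i + 1" G y] by (auto simp: admissible_def)
  qed
  have separate: "admissible G P (m - 1, i + 1, i + 1) y" "y (i + 1) < y j" "0 \<le> y (i + 1)" "y j \<le> P"
    if y: "admissible G P (m, j, i) y" and neq: "y (i + 1) \<noteq> y i" for y
  proof -
    have ch: "chain G j y" "y j \<le> P" "y i = y j" using y range by (auto simp: admissible_def)
    then have lt: "y (i + 1) < y i" using chain_antimono[OF ch(1), of i "i + 1"] neq range by simp
    then have "i \<in> drops G i y" using range by (simp add: drops_def)
    then have "card (drops G (i + 1) y) < m"
      using card_drops_less[of i G i y "i + 1"] y by (simp add: admissible_def)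
    then show "admissible G P (m - 1, i + 1, i + 1) y"
      using ch lt chain_mono[of G j y "i + 1"] range by (simp add: admissible_def)
    show "y (i + 1) < y j" "y j \<le> P" using lt ch by auto
    show "0 \<le> y (i + 1)" using chain_nonneg[OF ch(1)] range by simp
  qed
  have activated_le: "tail G j y \<le> v"
    if y: "admissible G P (m, j, i) y" and neq: "y (i + 1) \<noteq> y i" for y
    using tail_admissible[OF y] f_term_le_argmax[of "y j" P j i] next_le[OF separate(1)[OF y neq]]
      separate(2-4)[OF y neq] range by (simp add: v_def x_def)
  show ?thesis
  proof (cases "v > tab_V T (m, j, i + 1) \<and> x > z")
    case True
    then have T: "tab_V T (m, j, i) = v" "tab_X T (m, j, i) = x"
        "tab_U T (m, j, i) = Some (m - 1, i + 1, i + 1)"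
      using entry by (simp_all add: entry_def step_entry_def Let_def x_def[symmetric]
          v_def[symmetric, simplified] z_def[symmetric, simplified])
    let ?s = "patch j i x s"
    have dec: "decodes T (m, j, i) ?s (n + 1)" using decodes.act[OF T(3) s(1)] range T by simp
    have adm: "admissible G P (m, j, i) ?s"
    proof -
      have "chain G j ?s"
        using s True range by (intro chain_patch) (auto simp: admissible_def)
      moreover have "card (drops G i ?s) \<le> m"
        using card_drops_patch[of j i G i x s] s(3) range by (auto simp: admissible_def)
      ultimately show ?thesis using range x by (auto simp: admissible_def patch_def)
    qed
    show ?thesis
    proof (rule entry_optimalI[OF dec _ adm])
      show "tail G j ?s = tab_V T (m, j, i)" using tail_patch[of j i G x s] s T range by (simp add: v_def)
      show "tail G j y \<le> tab_V T (m, j, i)" if "admissible G P (m, j, i) y" for y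
        using merged[OF that] activated_le[OF that] True T(1) by (cases "y (i + 1) = y i") auto
      show "n + 1 \<le> K - i + 1" using s(2) range by simp
      show "?s j = tab_X T (m, j, i)" using range T by (simp add: patch_def)
      show "\<exists>q\<in>{i..K}. tab_X T (m, j, i) = argmax_f G j q P"
        using T range by (intro bexI[of _ i]) (simp_all add: x_def)
    qed (use range in simp)
  next
    case False
    then have T: "tab_V T (m, j, i) = tab_V T (m, j, i + 1)" "tab_X T (m, j, i) = tab_X T (m, j, i + 1)"
        "tab_U T (m, j, i) = Some (m, j, i + 1)"
      using entry by (auto simp: entry_def step_entry_def Let_def x_def[symmetric]
          v_def[symmetric, simplified] z_def[symmetric, simplified] split: if_splits)
    obtain s' n' where s': "decodes T (m, j, i + 1) s' n'" "n' \<le> K - (i + 1) + 1"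
      "admissible G P (m, j, i + 1) s'" "s' j = tab_X T (m, j, i + 1)"
      "tail G j s' = tab_V T (m, j, i + 1)"
      using entry_optimal_solution[OF longer] by blast
    have dec: "decodes T (m, j, i) s' (n' + 1)" using decodes.inact[OF T(3) s'(1)] .
    have adm: "admissible G P (m, j, i) s'"
    proof -
      have eq: "s' l = s' j" if "j \<le> l" "l \<le> i + 1" for l
        using admissible_const[OF s'(3) that] .
      have "s' (i + 1) = s' i" using eq[of i] eq[of "i + 1"] range by simp
      then have "drops G i s' \<subseteq> drops G (i + 1) s'"
        by (auto simp: drops_def Suc_le_eq le_less)
      then have "card (drops G i s') \<le> card (drops G (i + 1) s')" by (simp add: card_mono)
      then show ?thesis using s'(3) eq[of i] range by (simp add: admissible_def)
    qed
    have le: "tail G j y \<le> tab_V T (m, j, i + 1)" if y: "admissible G P (m, j, i) y" for y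
    proof (cases "y (i + 1) = y i")
      case True
      then show ?thesis by (rule merged[OF y])
    next
      case neq: False
      note sep = separate[OF y neq]
      show ?thesis
      proof (cases "z < x")
        case True
        then show ?thesis using activated_le[OF y neq] False by simp
      next
        case False
        show ?thesis
        proof (cases "z \<le> y j")
          case True
          \<comment> \<open>Beyond its maximizer \<open>x \<le> z\<close> the block function decreases: lower the block to \<open>z\<close>.\<close>
          have "tail G j y \<le> f_term G j i z + tail G (i + 1) s"
            using tail_admissible[OF y] next_le[OF sep(1)] s(5) range sep True False
              f_term_antimono_above_argmax[of j i P z "y j"] by (simp add: x_def)
          also have "\<dots> = tail G j (patch j i z s)" using range by (simp add: tail_patch)
          also have "\<dots> \<le> tab_V T (m, j, i + 1)"
          proof (rule longer_le)
            have "chain G j (patch j i z s)"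
              using s range by (intro chain_patch) (auto simp: admissible_def)
            moreover have "drops G (i + 1) (patch j i z s) = drops G (i + 1) s"
              by (auto simp: drops_def patch_def)
            ultimately show "admissible G P (m, j, i + 1) (patch j i z s)"
              using s range sep True by (auto simp: admissible_def patch_def le_Suc_eq)
          qed
          finally show ?thesis .
        next
          case lt: False
          \<comment> \<open>The block function with maximizer \<open>z\<close> still rises at \<open>y j\<close>: raise the continuation.\<close>
          then have "z \<noteq> 0" "0 < y j" using sep by auto
          then obtain q0 where q0: "q0 \<in> {i + 1..K}" "z = argmax_f G (i + 1) q0 P"
            using entry_optimal_power[OF next_block] unfolding z_def by blast
          have "rising G (i + 1) q0 (y j)"
            using rising_below_argmax_f[of "y j" "i + 1" q0 P] q0 lt \<open>0 < y j\<close> by simp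
          moreover have ch: "chain G (i + 1) y" using sep(1) by (simp add: admissible_def)
          ultimately obtain q where q: "q \<in> {i + 1..q0}"
              "(\<Sum>l = i + 1..q. f_term G l l (y l)) \<le> f_term G (i + 1) q (y j)"
            using raise_to[of "i + 1" q0 "y j" y] q0 chain_nonneg[OF ch] sep(2)
            by (auto simp: chain_def)
          have qK: "q \<le> K" using q(1) q0(1) by simp
          have "tail G j y = f_term G j i (y j) + (\<Sum>l = i + 1..q. f_term G l l (y l)) + tail G (q + 1) y"
            using tail_admissible[OF y] tail_split[of "i + 1" q G y] range q(1) qK by simp
          also have "\<dots> \<le> f_term G j q (y j) + tail G (q + 1) y"
            using q f_term_split[of j i q G "y j"] range by simp
          also have "\<dots> = tail G j (patch j q (y j) y)"
            using q(1) qK range by (simp add: tail_patch)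
          also have "\<dots> \<le> tab_V T (m, j, i + 1)"
          proof (rule longer_le)
            have "chain G j (patch j q (y j) y)"
              using chain_mono[OF ch, of "q + 1"] chain_antimono[OF ch, of "i + 1" "q + 1"] q(1) qK sep
              by (intro chain_patch) auto
            moreover have "card (drops G (i + 1) (patch j q (y j) y)) \<le> m"
              using card_drops_patch[of j "i + 1" G q "y j" y] sep(1) range q(1)
                card_drops_antimono[of "i + 1" "q + 1" G y] by (auto simp: admissible_def)
            ultimately show "admissible G P (m, j, i + 1) (patch j q (y j) y)"
              using q(1) sep range by (auto simp: admissible_def patch_def)
          qed
          finally show ?thesis .
        qed
      qed
    qed
    have power: "\<exists>q\<in>{i..K}. tab_X T (m, j, i) = argmax_f G j q P"
    proof -
      obtain q where "q \<in> {i + 1..K}" "tab_X T (m, j, i + 1) = argmax_f G j q P"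
        using entry_optimal_power[OF longer] range by auto
      then show ?thesis using T(2) by (intro bexI[of _ q]) auto
    qed
    show ?thesis
    proof (rule entry_optimalI[OF dec _ adm])
      show "tail G j s' = tab_V T (m, j, i)" using s'(5) T(1) by simp
      show "tail G j y \<le> tab_V T (m, j, i)" if "admissible G P (m, j, i) y" for y
        using le[OF that] T(1) by simp
      show "n' + 1 \<le> K - i + 1" using s'(2) range by simp
      show "s' j = tab_X T (m, j, i)" using s'(4) T(2) by simp
    qed (use power range in simp_all)
  qed
qed

theorem table_optimal:
  assumes "dp_table G M P T" "0 \<le> P" "m \<le> M" "1 \<le> j" "j \<le> i" "i \<le> K"
  shows "entry_optimal G P T (m, j, i)"
  using assms(6,3-5)
proof (induction i arbitrary: m j rule: inc_induct)
  case base
  have "entry_ok G P T (m, j, K)" using assms(1) base by (simp add: dp_table_def)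
  then show ?case
    using entry_optimal_zero[of T j K P] entry_optimal_last[of T m j "argmax_f G j K P" P] base assms(2)
    by (cases "m = 0") (auto simp: entry_ok_def Let_def)
next
  case (step i)
  have ok: "entry_ok G P T (m, j, i)" using assms(1) step by (simp add: dp_table_def)
  show ?case
  proof (cases "m = 0")
    case True
    then show ?thesis
      using entry_optimal_zero[of T j i P] ok step assms(2) by (simp add: entry_ok_def Let_def)
  next
    case False
    show ?thesis
    proof (rule entry_optimal_step)
      show "entry T (m, j, i) = step_entry G P T (m, j, i)"
        using ok step False by (simp add: entry_ok_def Let_def)
      show "entry_optimal G P T (m - 1, i + 1, i + 1)"
        using step.IH[of "m - 1" "i + 1"] step by simp
      show "entry_optimal G P T (m, j, i + 1)"
        using step.IH[of m j] step by simp
    qed (use step False assms(2) in auto)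
  qed
qed

end

section \<open>Clipping the precomputed vectors\<close>

context sorted_subcarrier
begin

lemma argmax_f_first [simp]: "argmax_f G (Suc 0) i P = P"
  by (simp add: argmax_f_def)

text \<open>
  A competitor whose powers are \<open>P\<close> on \<open>1, \<dots>, i\<close> and \<open>x\<close> afterwards is dominated by one of the
  precomputed vectors, clipped at \<open>P\<close>.  The induction lengthens the first block, that is, it runs
  downwards in \<open>i\<close>.
\<close>

lemma clipped_covers:
  assumes T: "dp_table G M Pmax T" and M: "1 \<le> M" and P: "0 < P" "P \<le> Pmax"
    and i: "1 \<le> i" "i \<le> K"
    and x: "chain G (i + 1) x" "x (i + 1) \<le> P" "card (drops G (i + 1) x) < M"
  shows "\<exists>q\<in>{1..K}. f_term G 1 i P + tail G (i + 1) x
    \<le> tail G 1 (\<lambda>l. min (result (retrieve T (M, 1, q)) l) P)"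
  using i x
proof (induction "K - i" arbitrary: i x rule: less_induct)
  case less
  note i = less.prems(1,2) and x = less.prems(3-5)
  note x_nonneg = chain_nonneg[OF x(1)]
  \<comment> \<open>Reduction to a longer first block, for a continuation \<open>y\<close> no worse than \<open>x\<close>.\<close>
  have shift: ?case
    if q: "i + 1 \<le> q" "q \<le> K" and y: "chain G (i + 1) y" "y (q + 1) \<le> P" "card (drops G (q + 1) y) < M"
      and block: "(\<Sum>l = i + 1..q. f_term G l l (y l)) \<le> f_term G (i + 1) q P"
      and le: "tail G (i + 1) x \<le> tail G (i + 1) y" for q y
  proof -
    have "f_term G 1 i P + tail G (i + 1) x \<le> f_term G 1 q P + tail G (q + 1) y"
      using le block tail_split[of "i + 1" q G y] f_term_split[of 1 i q G P] q i by simp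
    moreover have "\<exists>q'\<in>{1..K}. f_term G 1 q P + tail G (q + 1) y
        \<le> tail G 1 (\<lambda>l. min (result (retrieve T (M, 1, q')) l) P)"
      using less.hyps[of q y] q i y chain_mono[OF y(1), of "q + 1"] by simp
    ultimately show ?thesis by (meson order_trans)
  qed
  show ?case
  proof (cases "i = K")
    case True
    have "entry_ok G Pmax T (M, 1, K)" using T K_ge_1 by (simp add: dp_table_def)
    then have "tab_U T (M, 1, K) = None" "tab_X T (M, 1, K) = Pmax"
      using M by (simp_all add: entry_ok_def entry_def Let_def)
    then have "retrieve T (M, 1, K) = Done (patch 1 K Pmax (\<lambda>_. 0)) 1"
      using retrieve_decodes[OF decodes.stop[of T M 1 K]] by simp
    then have "tail G 1 (\<lambda>l. min (result (retrieve T (M, 1, K)) l) P) = f_term G 1 K P"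
      using tail_block[of 1 K G _ P] K_ge_1 P by (simp add: patch_def)
    then show ?thesis using True K_ge_1 by (intro bexI[of _ K]) auto
  next
    case False
    then have iK: "i < K" using i by simp
    show ?thesis
    proof (cases "\<exists>q0\<in>{i + 1..K}. rising G (i + 1) q0 P")
      case True
      then obtain q0 where q0: "q0 \<in> {i + 1..K}" "rising G (i + 1) q0 P" by blast
      then obtain q where q: "q \<in> {i + 1..q0}"
          "(\<Sum>l = i + 1..q. f_term G l l (x l)) \<le> f_term G (i + 1) q P"
        using raise_to[of "i + 1" q0 P x] x x_nonneg by (auto simp: chain_def)
      have "x (q + 1) \<le> P" using chain_antimono[OF x(1), of "i + 1" "q + 1"] x(2) q(1) by simp
      moreover have "card (drops G (q + 1) x) < M"
        using card_drops_antimono[of "i + 1" "q + 1" G x] x(3) q(1) by simp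
      ultimately show ?thesis using shift[of q x] q q0 x by simp
    next
      case False
      then have falling: "falling G (i + 1) q P" if "i + 1 \<le> q" "q \<le> K" for q
        using that falling_if_not_rising by auto
      have opt: "entry_optimal G Pmax T (M - 1, i + 1, i + 1)"
        using table_optimal[OF T, of "M - 1" "i + 1" "i + 1"] P iK by simp
      define z where "z = tab_X T (M - 1, i + 1, i + 1)"
      obtain s n where s: "decodes T (M - 1, i + 1, i + 1) s n"
          "admissible G Pmax (M - 1, i + 1, i + 1) s" "s (i + 1) = z"
          "tail G (i + 1) s = tab_V T (M - 1, i + 1, i + 1)"
        using entry_optimal_solution[OF opt] unfolding z_def by blast
      have x_le: "tail G (i + 1) x \<le> tab_V T (M - 1, i + 1, i + 1)"
        using entry_optimal_le[OF opt, of x] x P by (auto simp: admissible_def)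
      have "z < P"
      proof (rule ccontr)
        assume "\<not> z < P"
        then have "z \<noteq> 0" using P by auto
        then obtain q where q: "q \<in> {i + 1..K}" "z = argmax_f G (i + 1) q Pmax"
          using entry_optimal_power[OF opt] unfolding z_def by blast
        then have "rising G (i + 1) q P"
          using rising_below_argmax_f[of P "i + 1" q Pmax] \<open>\<not> z < P\<close> P by simp
        then show False using False q by blast
      qed
      define v where "v = f_term G 1 i Pmax + tab_V T (M - 1, i + 1, i + 1)"
      have "entry_ok G Pmax T (M, 1, i)" using T i by (simp add: dp_table_def)
      then have entry: "entry T (M, 1, i) =
          (if v > tab_V T (M, 1, i + 1) then (v, Pmax, Some (M - 1, i + 1, i + 1))
           else (tab_V T (M, 1, i + 1), tab_X T (M, 1, i + 1), Some (M, 1, i + 1)))"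
        using M iK \<open>z < P\<close> P
        by (simp add: entry_ok_def step_entry_def Let_def v_def z_def)
      show ?thesis
      proof (cases "v > tab_V T (M, 1, i + 1)")
        case True
        then have U: "tab_U T (M, 1, i) = Some (M - 1, i + 1, i + 1)" "tab_X T (M, 1, i) = Pmax"
          using entry by (simp_all add: entry_def)
        have R: "result (retrieve T (M, 1, i)) = patch 1 i Pmax s"
          using retrieve_decodes[OF decodes.act[OF U(1) s(1)]] i U(2) by simp
        have "s l \<le> P" if "i + 1 \<le> l" for l
          using chain_antimono[of G "i + 1" s "i + 1" l] s(2,3) \<open>z < P\<close> that
          by (simp add: admissible_def)
        then have "tail G (i + 1) (\<lambda>l. min (patch 1 i Pmax s l) P) = tail G (i + 1) s"
          by (intro tail_cong) (simp add: patch_def)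
        then have "tail G 1 (\<lambda>l. min (patch 1 i Pmax s l) P) = f_term G 1 i P + tail G (i + 1) s"
          using tail_block[of 1 i G "\<lambda>l. min (patch 1 i Pmax s l) P" P] i P
          by (simp add: patch_def)
        then show ?thesis using R x_le s(4) i by (intro bexI[of _ i]) auto
      next
        case inact: False
        have opt': "entry_optimal G Pmax T (M, 1, i + 1)"
          using table_optimal[OF T, of M 1 "i + 1"] P iK by simp
        obtain s' n' where s': "admissible G Pmax (M, 1, i + 1) s'"
            "s' 1 = tab_X T (M, 1, i + 1)" "tail G 1 s' = tab_V T (M, 1, i + 1)"
          using entry_optimal_solution[OF opt'] by blast
        have "tab_X T (M, 1, i + 1) = Pmax"
          using entry_optimal_power[OF opt'] M
          by (metis argmax_f_first One_nat_def zero_less_Suc less_eq_Suc_le)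
        then have const: "s' l = Pmax" if "1 \<le> l" "l \<le> i + 1" for l
          using admissible_const[OF s'(1), of l] s'(2) that by simp
        have ch: "chain G 1 s'" using s'(1) by (simp add: admissible_def)
        have "tab_V T (M - 1, i + 1, i + 1) \<le> tail G (i + 1) s'"
          using inact s'(3) tail_block[of 1 i G s' Pmax] const i by (simp add: v_def)
        then have le: "tail G (i + 1) x \<le> tail G (i + 1) s'" using x_le by simp
        \<comment> \<open>The last position with power at least \<open>P\<close>; up to there the vector is lowered to \<open>P\<close>.  It
          is active in \<open>s'\<close>, which leaves fewer than \<open>M\<close> active users behind it.\<close>
        define r where "r = Max {l \<in> {i + 1..K}. P \<le> s' l}"
        have "i + 1 \<in> {l \<in> {i + 1..K}. P \<le> s' l}" using const[of "i + 1"] P iK by simp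
        then have "r \<in> {l \<in> {i + 1..K}. P \<le> s' l}" unfolding r_def by (intro Max_in) auto
        then have r: "i + 1 \<le> r" "r \<le> K" "P \<le> s' r" by auto
        have next_r: "s' (r + 1) < P"
        proof (cases "r = K")
          case True
          then show ?thesis using ch P by (simp add: chain_def)
        next
          case False
          show ?thesis
          proof (rule ccontr)
            assume "\<not> ?thesis"
            then have "r + 1 \<in> {l \<in> {i + 1..K}. P \<le> s' l}" using r False by simp
            then have "r + 1 \<le> r" unfolding r_def by (intro Max_ge) auto
            then show False by simp
          qed
        qed
        have "r \<in> drops G (i + 1) s'" using next_r r by (simp add: drops_def)
        then have "card (drops G (r + 1) s') < M"
          using card_drops_less[of r G "i + 1" s' "r + 1"] s'(1) by (simp add: admissible_def)
        moreover have "(\<Sum>l = i + 1..r. f_term G l l (s' l)) \<le> f_term G (i + 1) r P"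
        proof (rule lower_to)
          show "P \<le> s' l" if "i + 1 \<le> l" "l \<le> r" for l
            using chain_antimono[OF ch, of l r] r(3) that by simp
        qed (use falling r P ch in \<open>auto simp: chain_def\<close>)
        ultimately show ?thesis
          using shift[of r s'] r next_r chain_mono[OF ch, of "i + 1"] le by simp
      qed
    qed
  qed
qed

lemma feasible_chain:
  assumes "feasible G M P y" "x = (\<lambda>l. if l \<le> K then y l else 0)"
  shows "chain G 1 x" "x 1 \<le> P" "card (drops G 1 x) \<le> M" "objective G y = tail G 1 x + A_const G"
proof -
  have nx: "next_power G y i = x (i + 1)" if "i \<in> {1..K}" for i
    using that assms(2) by (auto simp: next_power_def)
  show "chain G 1 x" unfolding chain_def
  proof (intro conjI allI impI)
    fix l :: nat assume "1 \<le> l"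
    show "x (l + 1) \<le> x l"
    proof (cases "l \<le> K")
      case True
      then have "next_power G y l \<le> y l" using assms(1) \<open>1 \<le> l\<close> by (simp add: feasible_def)
      then show ?thesis using nx[of l] True \<open>1 \<le> l\<close> by (simp add: assms(2))
    qed (use assms(2) in simp)
  qed (use assms(2) in simp)
  show "x 1 \<le> P" using assms K_ge_1 by (simp add: feasible_def)
  have "drops G 1 x = active_users G y"
    using nx assms(2) by (auto simp: drops_def active_users_def)
  then show "card (drops G 1 x) \<le> M" using assms(1) by (simp add: feasible_def)
  show "objective G y = tail G 1 x + A_const G"
    unfolding objective_def using tail_cong[of 1 G x y] assms(2) by (simp add: tail_def)
qed

text \<open>
  For \<open>P = 0\<close> the zero vector is the only competitor.  Otherwise the first block of a competitor,
  the longest one with power \<open>x 1\<close>, can be raised to \<open>P\<close>.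
\<close>

lemma clipped_optimal:
  assumes T: "dp_table G M Pmax T" and M: "1 \<le> M" and P: "0 \<le> P" "P \<le> Pmax"
    and y: "feasible G M P y"
  shows "\<exists>q\<in>{1..K}. objective G y
    \<le> tail G 1 (\<lambda>l. min (result (retrieve T (M, 1, q)) l) P) + A_const G"
proof -
  define x where "x = (\<lambda>l. if l \<le> K then y l else 0)"
  note fx = feasible_chain[OF y x_def]
  show ?thesis
  proof (cases "P = 0")
    case True
    obtain s n where s: "decodes T (M, 1, K) s n" "admissible G Pmax (M, 1, K) s"
      using entry_optimal_solution[OF table_optimal[OF T, of M 1 K]] P K_ge_1
      by (metis order_refl order_trans)
    have "x l = 0" if "1 \<le> l" for l
      using chain_antimono[OF fx(1), of 1 l] chain_nonneg[OF fx(1), of l] fx(2) True that by simp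
    moreover have "min (s l) 0 = 0" if "1 \<le> l" for l
      using chain_nonneg[of G 1 s l] s(2) that by (simp add: admissible_def)
    ultimately have "tail G 1 x = tail G 1 (\<lambda>l. min (s l) P)"
      using True by (intro tail_cong) simp
    then show ?thesis using fx(4) retrieve_decodes[OF s(1)] K_ge_1 by (intro bexI[of _ K]) auto
  next
    case False
    define i where "i = Max {l \<in> {1..K}. x l = x 1}"
    have "1 \<in> {l \<in> {1..K}. x l = x 1}" using K_ge_1 by simp
    then have "i \<in> {l \<in> {1..K}. x l = x 1}" unfolding i_def by (intro Max_in) auto
    then have i: "1 \<le> i" "i \<le> K" "x i = x 1" by auto
    have adm: "admissible G P (M, 1, i) x"
      using fx i card_drops_antimono[of 1 i G x] by (simp add: admissible_def)
    have "tail G 1 x = f_term G 1 i (x 1) + tail G (i + 1) x"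
      using tail_admissible[OF adm] i by simp
    also have "\<dots> \<le> f_term G 1 i P + tail G (i + 1) x"
      using f_term_le_argmax[of "x 1" P 1 i] i fx(2) chain_nonneg[OF fx(1), of 1] by simp
    finally have le: "tail G 1 x \<le> f_term G 1 i P + tail G (i + 1) x" .
    have "card (drops G (i + 1) x) < M"
    proof (cases "i = K")
      case True
      then show ?thesis using M by (simp add: drops_def)
    next
      case False
      have "x (i + 1) \<noteq> x 1"
      proof
        assume "x (i + 1) = x 1"
        then have "i + 1 \<in> {l \<in> {1..K}. x l = x 1}" using i False by simp
        then have "i + 1 \<le> i" unfolding i_def by (intro Max_ge) auto
        then show False by simp
      qed
      then have "i \<in> drops G 1 x"
        using chain_antimono[OF fx(1), of i "i + 1"] i by (simp add: drops_def)
      then show ?thesis using card_drops_less[of i G 1 x "i + 1"] fx(3) by simp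
    qed
    moreover have "x (i + 1) \<le> P" using chain_antimono[OF fx(1), of 1 "i + 1"] fx(2) by simp
    ultimately obtain q where "q \<in> {1..K}" "f_term G 1 i P + tail G (i + 1) x
        \<le> tail G 1 (\<lambda>l. min (result (retrieve T (M, 1, q)) l) P)"
      using clipped_covers[OF T M _ P(2) i(1,2), of x] False P(1)
        chain_mono[OF fx(1), of "i + 1"] by auto
    then show ?thesis using fx(4) le by (intro bexI[of _ q]) auto
  qed
qed

end

section \<open>The programs of i-SCUS\<close>

text \<open>
  The active users in increasing order, as the program lists them.
\<close>

definition active_positions :: "subcarrier \<Rightarrow> (nat \<Rightarrow> real) \<Rightarrow> nat list" where
  "active_positions G x = filter (\<lambda>i. next_power G x i < x i) [1..<num_users G + 1]"

lemma runs_active_list: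
  "runs (active_list G x) (num_users G)
     (\<lambda>us. us = active_positions G x)"
  unfolding active_list_def
  by (rule runs_for_each[where B = 1 and
        Inv = "\<lambda>is us. us = filter (\<lambda>i. next_power G x i < x i) is"])
    (auto intro!: runs_charge simp: active_positions_def)

text \<open>
  The vector truncated at the budget \<open>P\<close>.
\<close>

definition clip :: "real \<Rightarrow> (nat \<Rightarrow> real) \<Rightarrow> nat \<Rightarrow> real" where
  "clip P x = (\<lambda>l. min (x l) P)"

lemma constant_without_drops:
  assumes "chain G 1 x" "\<And>l. p < l \<Longrightarrow> l \<le> q \<Longrightarrow> \<not> x (l + 1) < x l" "p < l" "l \<le> q + 1"
  shows "x l = x (q + 1)"
  using assms(4,3)
proof (induction l rule: inc_induct)
  case (step n)
  have "x (n + 1) \<le> x n" using chain_antimono[OF assms(1), of n "n + 1"] step by simp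
  then show ?case using assms(2)[of n] step by simp
qed simp

text \<open>
  The vector is constant between consecutive active users, so after the active users up to \<open>q\<close>
  the accumulated value is the sum over all positions up to the last of them.
\<close>

lemma runs_clipped_loop:
  assumes x: "chain G 1 x"
  shows "runs (for_each (filter (\<lambda>i. x (i + 1) < x i) [1..<q + 1]) (\<lambda>i (p, s). do {
            y \<leftarrow> charge 1 (min (x i) P);
            v \<leftarrow> eval_f G (p + 1) i y;
            s' \<leftarrow> charge 1 (s + v);
            return (i, s')
          }) (0, 0)) (11 * length (filter (\<lambda>i. x (i + 1) < x i) [1..<q + 1]))
     (\<lambda>(p, s). p \<le> q \<and> (\<forall>l. p < l \<and> l \<le> q \<longrightarrow> \<not> x (l + 1) < x l) \<and>
        s = (\<Sum>l = 1..p. f_term G l l (clip P x l)))"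
    (is "runs (for_each (?us q) ?body _) (?cost q) (?Q q)")
proof (induction q)
  case 0
  show ?case by (auto intro!: runs_charge)
next
  case (Suc q)
  have upt: "[1..<Suc q + 1] = [1..<q + 1] @ [q + 1]" by simp
  show ?case
  proof (cases "x (q + 2) < x (q + 1)")
    case True
    have us: "?us (Suc q) = ?us q @ [q + 1]" using True unfolding upt by simp
    show ?thesis
      unfolding us for_each_append
    proof (rule runs_bind[OF Suc.IH, where B' = 11], clarify)
      fix p :: nat assume p: "p \<le> q" "\<forall>l. p < l \<and> l \<le> q \<longrightarrow> \<not> x (l + 1) < x l"
      have "(\<Sum>l = 1..q + 1. f_term G l l (clip P x l)) =
          (\<Sum>l = 1..p. f_term G l l (clip P x l)) + (\<Sum>l = p + 1..q + 1. f_term G l l (clip P x l))"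
        using p(1) sum.ub_add_nat[of 1 p "\<lambda>l. f_term G l l (clip P x l)" "q + 1 - p"] by simp
      also have "(\<Sum>l = p + 1..q + 1. f_term G l l (clip P x l)) =
          f_term G (p + 1) (q + 1) (min (x (q + 1)) P)"
      proof (rule block_const)
        show "clip P x l = min (x (q + 1)) P" if "p + 1 \<le> l" "l \<le> q + 1" for l
          using constant_without_drops[OF x, of p q l] p that by (simp add: clip_def)
      qed (use p in simp_all)
      finally have sum: "(\<Sum>l = 1..q + 1. f_term G l l (clip P x l)) =
        (\<Sum>l = 1..p. f_term G l l (clip P x l)) + f_term G (p + 1) (q + 1) (min (x (q + 1)) P)" .
      show "runs (for_each [q + 1] ?body (p, \<Sum>l = 1..p. f_term G l l (clip P x l))) 11 (?Q (Suc q))"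
        unfolding for_each.simps prod.case eval_f_def
        by (rule runs_bind[where B = 11 and B' = 0
              and Q = "\<lambda>r. r = (q + 1, \<Sum>l = 1..q + 1. f_term G l l (clip P x l))"])
          (auto intro!: runs_charge_bind runs_charge
            simp: sum[unfolded One_nat_def add_Suc_right add_0_right]
            simp del: sum.cl_ivl_Suc)
    qed auto
  next
    case False
    have us: "?us (Suc q) = ?us q" using False unfolding upt by simp
    show ?thesis unfolding us
      by (rule runs_mono[OF Suc.IH]) (use False in \<open>auto simp: le_Suc_eq\<close>)
  qed
qed

context sorted_subcarrier
begin

lemma active_filter:
  assumes "chain G 1 x"
  shows "active_positions G x = filter (\<lambda>i. x (i + 1) < x i) [1..<K + 1]"
  unfolding active_positions_def using assms by (intro filter_cong) (auto simp: next_power_def chain_def le_less)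

lemma length_active_filter:
  "length (filter (\<lambda>i. x (i + 1) < x i) [1..<K + 1]) = card (drops G 1 x)"
proof -
  have "set (filter (\<lambda>i. x (i + 1) < x i) [1..<K + 1]) = drops G 1 x"
    by (auto simp: drops_def)
  then show ?thesis by (metis distinct_card distinct_filter distinct_upt)
qed

lemma runs_clipped_value:
  assumes x: "chain G 1 x" and M: "card (drops G 1 x) \<le> M" and P: "0 \<le> P"
    and us: "us = active_positions G x"
  shows "runs (clipped_value G P (us, x)) (11 * M + 16)
    (\<lambda>v. v = tail G 1 (clip P x) + A_const G)"
  unfolding clipped_value_def Let_def fst_conv snd_conv us active_filter[OF x]
proof (rule runs_bind[OF runs_clipped_loop[OF x, of K P], where B' = 16], clarify)
  fix p assume p: "p \<le> K" "\<forall>l. p < l \<and> l \<le> K \<longrightarrow> \<not> x (l + 1) < x l"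
  have zero: "clip P x l = 0" if "p + 1 \<le> l" "l \<le> K" for l
    using constant_without_drops[OF x, of p K l] p(2) x P that by (simp add: clip_def chain_def)
  have split: "tail G 1 (clip P x) = (\<Sum>l = 1..p. f_term G l l (clip P x l)) + tail G (p + 1) (clip P x)"
    using tail_split[of 1 p G "clip P x"] p(1) by simp
  have rest: "tail G (p + 1) (clip P x) = f_term G (p + 1) K 0" if "p \<noteq> K"
    using tail_block[of "p + 1" K G "clip P x" 0] zero that p(1) by simp
  show "runs (eval_A G \<bind> (\<lambda>a. charge 1 (p = K) \<bind> (\<lambda>full.
      if full then charge 1 ((\<Sum>l = 1..p. f_term G l l (clip P x l)) + a)
      else eval_f G (p + 1) K 0 \<bind>
        (\<lambda>v. charge 2 ((\<Sum>l = 1..p. f_term G l l (clip P x l)) + (v + a)))))) 16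
    (\<lambda>v. v = tail G 1 (clip P x) + A_const G)"
  proof (cases "p = K")
    case True
    then show ?thesis unfolding eval_A_def
      by (auto intro!: runs_charge_bind runs_charge simp: tail_def)
  next
    case False
    then show ?thesis unfolding eval_A_def eval_f_def
      by (auto intro!: runs_charge_bind runs_charge
          simp: split[unfolded One_nat_def add_Suc_right add_0_right]
            rest[unfolded One_nat_def add_Suc_right add_0_right])
  qed
next
  show "11 * length (filter (\<lambda>i. x (i + 1) < x i) [1..<K + 1]) + 16 \<le> 11 * M + 16"
    using M length_active_filter[of x] by simp
qed

text \<open>
  The collection produced by the precomputation.
\<close>

definition precomputed :: "nat \<Rightarrow> real \<Rightarrow> collection \<Rightarrow> bool" where
  "precomputed M Pmax coll \<longleftrightarrow> (\<exists>T. dp_table G M Pmax T \<and>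
     coll = map (\<lambda>i. let x = result (retrieve T (M, 1, i)) in (active_positions G x, x)) [1..<K + 1])"

lemma retrieved:
  assumes T: "dp_table G M Pmax T" and "0 \<le> Pmax" "1 \<le> i" "i \<le> K" and R: "x = result (retrieve T (M, 1, i))"
  shows "runs (retrieve T (M, 1, i)) K (\<lambda>y. y = x)" "chain G 1 x" "card (drops G 1 x) \<le> M"
proof -
  obtain s n where s: "decodes T (M, 1, i) s n" "n \<le> K - i + 1" "admissible G Pmax (M, 1, i) s"
    using entry_optimal_solution[OF table_optimal[OF T, of M 1 i]] assms by (metis order_refl)
  have x: "retrieve T (M, 1, i) = Done x n" "x = s"
    using retrieve_decodes[OF s(1)] R by simp_all
  show "runs (retrieve T (M, 1, i)) K (\<lambda>y. y = x)"
    using x s(2) assms(3,4) by (auto simp: runs_def)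
  show ch: "chain G 1 x" using s(3) x by (simp add: admissible_def)
  have "drops G 1 x \<subseteq> drops G i x"
  proof
    fix l assume l: "l \<in> drops G 1 x"
    have "i \<le> l"
    proof (rule ccontr)
      assume "\<not> i \<le> l"
      then have "x (l + 1) = x 1" "x l = x 1"
        using l admissible_const[OF s(3), of l] admissible_const[OF s(3), of "l + 1"] x(2)
        by (simp_all add: drops_def)
      then show False using l by (simp add: drops_def)
    qed
    then show "l \<in> drops G i x" using l by (simp add: drops_def)
  qed
  then have "card (drops G 1 x) \<le> card (drops G i x)" by (simp add: card_mono)
  then show "card (drops G 1 x) \<le> M" using s(3) x(2) by (simp add: admissible_def)
qed

lemma runs_iscus_precompute:
  assumes "0 \<le> Pmax" "1 \<le> M"
  shows "runs (iscus_precompute G M Pmax) (50 * (M * (K * K))) (precomputed M Pmax)"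
  unfolding iscus_precompute_def
proof (rule runs_bind[OF runs_scus_tables[OF refl], where B' = "K * (K + K)"])
  fix T assume T: "dp_table G M Pmax T"
  let ?e = "\<lambda>i. let x = result (retrieve T (M, 1, i)) in (active_positions G x, x)"
  show "runs (for_each [1..<K + 1] (\<lambda>i coll. do {
       x \<leftarrow> retrieve T (M, 1, i);
       us \<leftarrow> active_list G x;
       return (coll @ [(us, x)])
     }) []) (K * (K + K)) (precomputed M Pmax)"
  proof (rule runs_for_each[where B = "K + K" and Inv = "\<lambda>is coll. coll = map ?e is"])
    fix pre i post coll
    assume split: "[1..<K + 1] = pre @ i # post" and coll: "coll = map ?e pre"
    have "i \<in> set [1..<K + 1]" using split by simp
    then have i: "1 \<le> i" "i \<le> K" by auto
    show "runs (do {
       x \<leftarrow> retrieve T (M, 1, i);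
       us \<leftarrow> active_list G x;
       return (coll @ [(us, x)])
     }) (K + K) (\<lambda>coll. coll = map ?e (pre @ [i]))"
    proof (rule runs_bind[OF retrieved(1)[OF T assms(1) i refl]])
      fix x assume x: "x = result (retrieve T (M, 1, i))"
      show "runs (active_list G x \<bind> (\<lambda>us. return (coll @ [(us, x)]))) K (\<lambda>coll. coll = map ?e (pre @ [i]))"
        by (rule runs_bind[OF runs_active_list, where B' = 0])
          (auto intro!: runs_charge simp: x coll Let_def)
    qed simp
  qed (use T in \<open>auto simp: precomputed_def\<close>)
next
  have "K * K \<le> M * (K * K)" "M * K \<le> M * (K * K)" using assms(2) K_ge_1 by auto
  moreover have "K * (K * 9) + M * (K * 18) + K * (M * (K * 21)) + K * (K + K) =
      11 * (K * K) + 18 * (M * K) + 21 * (M * (K * K))"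
    by (simp add: algebra_simps)
  ultimately show "K * (K * 9) + M * (K * 18) + K * (M * (K * 21)) + K * (K + K) \<le> 50 * (M * (K * K))"
    by linarith
qed

lemma clip_optimal:
  assumes x: "chain G 1 x" "card (drops G 1 x) \<le> M" and P: "0 \<le> P"
    and le: "\<And>y. feasible G M P y \<Longrightarrow> objective G y \<le> tail G 1 (clip P x) + A_const G"
  shows "optimal_solution G M P (\<lambda>l. if l \<in> {1..K} then clip P x l else 0)"
proof -
  let ?y = "\<lambda>l. if l \<in> {1..K} then clip P x l else 0"
  have nx: "next_power G ?y i = clip P x (i + 1)" if "i \<in> {1..K}" for i
    using that x(1) P by (auto simp: next_power_def clip_def chain_def)
  have mono: "clip P x (i + 1) \<le> clip P x i" if "i \<in> {1..K}" for i
    using that chain_antimono[OF x(1), of i "i + 1"] by (simp add: clip_def)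
  have "active_users G ?y \<subseteq> drops G 1 x"
    using nx by (auto simp: active_users_def drops_def clip_def split: if_splits)
  then have "card (active_users G ?y) \<le> M"
    using x(2) card_mono[of "drops G 1 x" "active_users G ?y"] by simp
  moreover have "?y 1 \<le> P" using K_ge_1 by (simp add: clip_def)
  moreover have "next_power G ?y i \<le> ?y i" if "i \<in> {1..K}" for i
    using nx[OF that] mono[OF that] that by simp
  ultimately have "feasible G M P ?y" by (simp add: feasible_def)
  moreover have "objective G ?y = tail G 1 (clip P x) + A_const G"
    using tail_cong[of 1 G ?y "clip P x"] by (simp add: objective_def tail_def)
  ultimately show ?thesis using le by (simp add: optimal_solution_def)
qed

lemma runs_iscus_eval:
  assumes coll: "precomputed M Pmax coll" and M: "1 \<le> M" and P: "0 \<le> P" "P \<le> Pmax"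
  shows "runs (iscus_eval G coll P) (29 * (M * K)) (optimal_solution G M P)"
proof -
  obtain T where T: "dp_table G M Pmax T"
    and coll_eq: "coll = map
      (\<lambda>i. let x = result (retrieve T (M, 1, i)) in (active_positions G x, x)) [1..<K + 1]"
    using coll by (auto simp: precomputed_def)
  define val where "val x = tail G 1 (clip P x) + A_const G" for x
  have elem: "snd e \<in> (\<lambda>i. result (retrieve T (M, 1, i))) ` {1..K}"
      "fst e = active_positions G (snd e)"
      "chain G 1 (snd e)" "card (drops G 1 (snd e)) \<le> M"
    if e: "e \<in> set coll" for e
  proof -
    obtain i where i: "i \<in> {1..K}" "snd e = result (retrieve T (M, 1, i))"
        "fst e = active_positions G (snd e)"
    proof -
      obtain i where "i \<in> set [1..<K + 1]"
          "e = (active_positions G (result (retrieve T (M, 1, i))), result (retrieve T (M, 1, i)))"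
        using e unfolding coll_eq set_map Let_def by blast
      then show ?thesis using that[of i] by (simp add: less_Suc_eq_le del: upt_Suc)
    qed
    then show "snd e \<in> (\<lambda>i. result (retrieve T (M, 1, i))) ` {1..K}"
      "fst e = active_positions G (snd e)" by auto
    show "chain G 1 (snd e)" "card (drops G 1 (snd e)) \<le> M"
      using retrieved(2,3)[OF T _ _ _ i(2)] i(1) P by auto
  qed
  have collected: "result (retrieve T (M, 1, q)) \<in> snd ` set coll" if "q \<in> {1..K}" for q
    using that unfolding coll_eq by (force simp: Let_def image_image)
  define best_in :: "collection \<Rightarrow> (real \<times> (nat \<Rightarrow> real)) option \<Rightarrow> bool" where "best_in es b \<longleftrightarrow>
      (if es = [] then b = None
       else \<exists>x. b = Some (val x, x) \<and> x \<in> snd ` set es \<and> (\<forall>x'\<in>snd ` set es. val x' \<le> val x))" for es b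
  have choose: "runs (iscus_choose G coll P) (K * (11 * M + 17))
    (\<lambda>x. x \<in> snd ` set coll \<and> (\<forall>x'\<in>snd ` set coll. val x' \<le> val x))"
    unfolding iscus_choose_def
  proof (rule runs_bind[where B' = 0 and Q = "best_in coll"])
    show "runs (for_each coll (\<lambda>e best. do {
       v \<leftarrow> clipped_value G P e;
       case best of
         None \<Rightarrow> return (Some (v, snd e))
       | Some (v', x') \<Rightarrow> charge 1 (if v > v' then Some (v, snd e) else Some (v', x'))
     }) None) (K * (11 * M + 17)) (best_in coll)"
    proof (rule runs_for_each[where B = "11 * M + 17" and Inv = best_in])
      fix pre e post best
      assume split: "coll = pre @ e # post" and best: "best_in pre best"
      have e: "e \<in> set coll" using split by simp
      have cv: "runs (clipped_value G P e) (11 * M + 16) (\<lambda>v. v = val (snd e))"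
        using runs_clipped_value[OF elem(3,4)[OF e] P(1) elem(2)[OF e]] by (simp add: val_def)
      show "runs (do {
         v \<leftarrow> clipped_value G P e;
         case best of
           None \<Rightarrow> return (Some (v, snd e))
         | Some (v', x') \<Rightarrow> charge 1 (if v > v' then Some (v, snd e) else Some (v', x'))
       }) (11 * M + 17) (best_in (pre @ [e]))"
      proof (rule runs_bind[OF cv, where B' = 1])
        fix v assume v: "v = val (snd e)"
        show "runs (case best of
           None \<Rightarrow> return (Some (v, snd e))
         | Some (v', x') \<Rightarrow> charge 1 (if v > v' then Some (v, snd e) else Some (v', x'))) 1
          (best_in (pre @ [e]))"
        proof (cases "pre = []")
          case True
          then show ?thesis using best v by (auto simp: best_in_def intro!: runs_charge)
        next
          case False
          then obtain x where x: "best = Some (val x, x)" "x \<in> snd ` set pre"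
              "\<forall>x'\<in>snd ` set pre. val x' \<le> val x"
            using best by (auto simp: best_in_def)
          show ?thesis
          proof (cases "v > val x")
            case True
            then have "\<forall>x'\<in>snd ` set (pre @ [e]). val x' \<le> val (snd e)" using x(3) v by force
            then show ?thesis using x(1) v True by (simp add: best_in_def runs_charge)
          next
            case False
            then have "\<forall>x'\<in>snd ` set (pre @ [e]). val x' \<le> val x" using x(3) v by auto
            then show ?thesis using x(1,2) v False by (simp add: best_in_def runs_charge)
          qed
        qed
      qed simp
    qed (simp_all add: best_in_def coll_eq)
  next
    fix b assume "best_in coll b"
    moreover have "coll \<noteq> []" using K_ge_1 by (simp add: coll_eq)
    ultimately obtain x where x: "b = Some (val x, x)" "x \<in> snd ` set coll"
        "\<forall>x'\<in>snd ` set coll. val x' \<le> val x"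
      by (auto simp only: best_in_def if_False)
    show "runs (return (snd (the b))) 0
        (\<lambda>x. x \<in> snd ` set coll \<and> (\<forall>x'\<in>snd ` set coll. val x' \<le> val x))"
      unfolding x(1) option.sel snd_conv by (intro runs_charge conjI x(2,3) order_refl)
  qed simp
  show ?thesis
    unfolding iscus_eval_def
  proof (rule runs_bind[OF choose, where B' = K], elim conjE)
    fix x assume x: "x \<in> snd ` set coll" and best: "\<forall>x'\<in>snd ` set coll. val x' \<le> val x"
    have x_props: "chain G 1 x" "card (drops G 1 x) \<le> M" using x elem(3,4) by auto
    have "optimal_solution G M P (\<lambda>l. if l \<in> {1..K} then clip P x l else 0)"
    proof (rule clip_optimal[OF x_props P(1)])
      fix y assume "feasible G M P y"
      then obtain q where "q \<in> {1..K}" "objective G y \<le> val (result (retrieve T (M, 1, q)))"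
        using clipped_optimal[OF T M P] unfolding val_def clip_def by blast
      then show "objective G y \<le> tail G 1 (clip P x) + A_const G"
        using best collected[of q] unfolding val_def by fastforce
    qed
    moreover have "set [1..<K + 1] = {1..K}" by auto
    ultimately have opt: "optimal_solution G M P (\<lambda>l. if l \<in> set [1..<K + 1] then clip P x l else 0)"
      by (simp only:)
    show "runs (for_each [1..<K + 1] (\<lambda>i y. charge 1 (y(i := min (x i) P))) (\<lambda>_. 0)) K
        (optimal_solution G M P)"
    proof (rule runs_for_each[where B = 1 and
          Inv = "\<lambda>is y. y = (\<lambda>l. if l \<in> set is then clip P x l else 0)"])
      show "optimal_solution G M P y"
        if "y = (\<lambda>l. if l \<in> set [1..<K + 1] then clip P x l else 0)" for y
        using opt that by (simp only:)
    qed (auto intro!: runs_charge simp: clip_def)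
  next
    have "K \<le> M * K" using M by simp
    moreover have "K * (11 * M + 17) + K = 11 * (M * K) + 18 * K" by (simp add: algebra_simps)
    ultimately show "K * (11 * M + 17) + K \<le> 29 * (M * K)" by linarith
  qed
qed

lemma runs_iscus:
  assumes "1 \<le> M" "0 \<le> Pmax" "set Ps \<subseteq> {0..Pmax}"
  shows "runs (iscus G M Pmax Ps) (50 * (M * (K * K)) + length Ps * (29 * (M * K)))
    (list_all2 (optimal_solution G M) Ps)"
  unfolding iscus_def
proof (rule runs_bind[OF runs_iscus_precompute[OF assms(2,1)]])
  fix coll assume coll: "precomputed M Pmax coll"
  show "runs (for_each Ps (\<lambda>P ys. iscus_eval G coll P \<bind> (\<lambda>y. return (ys @ [y]))) [])
      (length Ps * (29 * (M * K))) (list_all2 (optimal_solution G M) Ps)"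
  proof (rule runs_for_each[where B = "29 * (M * K)" and Inv = "list_all2 (optimal_solution G M)"])
    fix pre P post ys
    assume split: "Ps = pre @ P # post" and inv: "list_all2 (optimal_solution G M) pre ys"
    have "P \<in> set Ps" using split by simp
    then have "P \<in> {0..Pmax}" using assms(3) by blast
    then have P: "0 \<le> P" "P \<le> Pmax" by auto
    show "runs (iscus_eval G coll P \<bind> (\<lambda>y. return (ys @ [y]))) (29 * (M * K))
        (list_all2 (optimal_solution G M) (pre @ [P]))"
      by (rule runs_bind[OF runs_iscus_eval[OF coll assms(1) P], where B' = 0])
        (auto intro!: runs_charge list_all2_appendI inv)
  qed simp_all
qed simp

end

theorem theorem6:
  shows
    "(\<forall>(G, M, Pmax) \<in> precompute_inputs. iscus_precompute G M Pmax \<noteq> Diverge) \<and>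
     (\<lambda>(G, M, Pmax). real (cost (iscus_precompute G M Pmax)))
       \<in> O[principal precompute_inputs](\<lambda>(G, M, Pmax). real M * real (num_users G) ^ 2) \<and>
     (\<forall>(G, M, Pmax, P) \<in> eval_inputs.
        iscus_eval G (result (iscus_precompute G M Pmax)) P \<noteq> Diverge) \<and>
     (\<lambda>(G, M, Pmax, P). real (cost (iscus_eval G (result (iscus_precompute G M Pmax)) P)))
       \<in> O[principal eval_inputs](\<lambda>(G, M, Pmax, P). real M * real (num_users G)) \<and>
     (\<forall>(G, M, Pmax, Ps) \<in> iscus_inputs.
        iscus G M Pmax Ps \<noteq> Diverge \<and>
        list_all2 (optimal_solution G M) Ps (result (iscus G M Pmax Ps))) \<and>
     (\<lambda>(G, M, Pmax, Ps). real (cost (iscus G M Pmax Ps)))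
       \<in> O[principal iscus_inputs](\<lambda>(G, M, Pmax, Ps).
            real M * real (num_users G) ^ 2 + real (length Ps) * real M * real (num_users G))"
proof -
  have pre: "iscus_precompute G M Pmax \<noteq> Diverge"
      "real (cost (iscus_precompute G M Pmax)) \<le> 50 * (real M * real (num_users G) ^ 2)"
      "sorted_subcarrier.precomputed G M Pmax (result (iscus_precompute G M Pmax))"
    if "(G, M, Pmax) \<in> precompute_inputs" for G M Pmax
  proof -
    interpret sorted_subcarrier G
      using that by unfold_locales (simp add: precompute_inputs_def)
    have *: "runs (iscus_precompute G M Pmax) (50 * (M * (K * K))) (precomputed M Pmax)"
      using that by (intro runs_iscus_precompute) (auto simp: precompute_inputs_def)
    show "iscus_precompute G M Pmax \<noteq> Diverge" "precomputed M Pmax (result (iscus_precompute G M Pmax))"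
      using runsD[OF *] by auto
    have "real (cost (iscus_precompute G M Pmax)) \<le> real (50 * (M * (K * K)))"
      using runsD[OF *] by (simp only: of_nat_le_iff)
    then show "real (cost (iscus_precompute G M Pmax)) \<le> 50 * (real M * real (num_users G) ^ 2)"
      by (simp add: power2_eq_square)
  qed
  have eval: "iscus_eval G (result (iscus_precompute G M Pmax)) P \<noteq> Diverge"
      "real (cost (iscus_eval G (result (iscus_precompute G M Pmax)) P)) \<le> 29 * (real M * real (num_users G))"
    if "(G, M, Pmax, P) \<in> eval_inputs" for G M Pmax P
  proof -
    have in_pre: "(G, M, Pmax) \<in> precompute_inputs" "0 \<le> P" "P \<le> Pmax"
      using that by (auto simp: eval_inputs_def)
    interpret sorted_subcarrier G
      using in_pre(1) by unfold_locales (simp add: precompute_inputs_def)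
    have *: "runs (iscus_eval G (result (iscus_precompute G M Pmax)) P) (29 * (M * K)) (optimal_solution G M P)"
      using in_pre by (intro runs_iscus_eval[OF pre(3)]) (auto simp: precompute_inputs_def)
    show "iscus_eval G (result (iscus_precompute G M Pmax)) P \<noteq> Diverge" using runsD[OF *] by auto
    have "real (cost (iscus_eval G (result (iscus_precompute G M Pmax)) P)) \<le> real (29 * (M * K))"
      using runsD[OF *] by (simp only: of_nat_le_iff)
    then show "real (cost (iscus_eval G (result (iscus_precompute G M Pmax)) P)) \<le> 29 * (real M * real (num_users G))"
      by simp
  qed
  have all: "iscus G M Pmax Ps \<noteq> Diverge" "list_all2 (optimal_solution G M) Ps (result (iscus G M Pmax Ps))"
      "real (cost (iscus G M Pmax Ps)) \<le>
        50 * (real M * real (num_users G) ^ 2 + real (length Ps) * real M * real (num_users G))"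
    if "(G, M, Pmax, Ps) \<in> iscus_inputs" for G M Pmax Ps
  proof -
    have in_pre: "(G, M, Pmax) \<in> precompute_inputs" "set Ps \<subseteq> {0..Pmax}"
      using that by (auto simp: iscus_inputs_def)
    interpret sorted_subcarrier G
      using in_pre(1) by unfold_locales (simp add: precompute_inputs_def)
    have *: "runs (iscus G M Pmax Ps) (50 * (M * (K * K)) + length Ps * (29 * (M * K)))
      (list_all2 (optimal_solution G M) Ps)"
      using in_pre by (intro runs_iscus) (auto simp: precompute_inputs_def)
    show "iscus G M Pmax Ps \<noteq> Diverge" "list_all2 (optimal_solution G M) Ps (result (iscus G M Pmax Ps))"
      using runsD[OF *] by auto
    have "cost (iscus G M Pmax Ps) \<le> 50 * (M * (K * K) + length Ps * M * K)"
      using runsD[OF *] by (simp add: algebra_simps)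
    then have "real (cost (iscus G M Pmax Ps)) \<le> real (50 * (M * (K * K) + length Ps * M * K))"
      by (simp only: of_nat_le_iff)
    then show "real (cost (iscus G M Pmax Ps)) \<le>
        50 * (real M * real (num_users G) ^ 2 + real (length Ps) * real M * real (num_users G))"
      by (simp add: power2_eq_square)
  qed
  show ?thesis
  proof (intro conjI)
    show "(\<lambda>(G, M, Pmax). real (cost (iscus_precompute G M Pmax)))
       \<in> O[principal precompute_inputs](\<lambda>(G, M, Pmax). real M * real (num_users G) ^ 2)"
      by (rule bigoI[of _ 50]) (use pre(2) in \<open>auto simp: eventually_principal\<close>)
    show "(\<lambda>(G, M, Pmax, P). real (cost (iscus_eval G (result (iscus_precompute G M Pmax)) P)))
       \<in> O[principal eval_inputs](\<lambda>(G, M, Pmax, P). real M * real (num_users G))"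
      by (rule bigoI[of _ 29]) (use eval(2) in \<open>auto simp: eventually_principal abs_mult\<close>)
    show "(\<lambda>(G, M, Pmax, Ps). real (cost (iscus G M Pmax Ps)))
       \<in> O[principal iscus_inputs](\<lambda>(G, M, Pmax, Ps).
            real M * real (num_users G) ^ 2 + real (length Ps) * real M * real (num_users G))"
      by (rule bigoI[of _ 50]) (use all(3) in \<open>auto simp: eventually_principal\<close>)
  qed (use pre(1) eval(1) all(1,2) in auto)
qed

end
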